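(* Let $K$ be a compact metric space such that the maximal elements of the homogeneity pre-order relation of $K$ are all homogeneously equivalent. Denote by $K_m$ the greatest homogeneous component of $K$ for the homogeneity pre-order, and assume that $K_m$ has a non-empty interior. Then there is exactly one strongly isometrically compatible probability on $K$.
   Context: An isometric map is a distance-preserving map, not assumed surjective; an isometry is a surjective isometric map. On a metric space $K$: the homogeneity equivalence is $x\leftrightarrow y$ iff there are $\varepsilon>0$ and an isometry from $B(x;\varepsilon)$ onto $B(y;\varepsilon)$; its classes are the homogeneous components of $K$, and points in the same class are called homogeneously equivalent. The homogeneity pre-order is $x\hookrightarrow y$ iff there are $\varepsilon>0$ and an isometric map from $B(x;\varepsilon)$ to $B(y;\varepsilon)$ (here $y$ is larger than $x$); on a compact metric space it induces an order on homogeneous components. A Borel measure $m$ on a metric space $E$ is strongly isometrically compatible if for every isometric map $f:O\to O'$ between open sets of $E$ ($f$ not necessarily surjective), $m(f(O))=m(O)$.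
   Formalization: In both homogeneity relations the isometry or isometric map from B(x;ε) to B(y;ε) is required to send x to y; without this, a large ε makes all points of a compact space equivalent and the claim fails. *)

theory Defs
  imports "HOL-Probability.Probability"
begin

definition isometric_map ::
    "('a::metric_space) set \<Rightarrow> ('b::metric_space) set \<Rightarrow> ('a \<Rightarrow> 'b) \<Rightarrow> bool" where
  "isometric_map X Y f \<longleftrightarrow> f ` X \<subseteq> Y \<and> (\<forall>x\<in>X. \<forall>y\<in>X. dist (f x) (f y) = dist x y)"

definition isometry_between ::
    "('a::metric_space) set \<Rightarrow> ('b::metric_space) set \<Rightarrow> ('a \<Rightarrow> 'b) \<Rightarrow> bool" where
  "isometry_between X Y f \<longleftrightarrow> isometric_map X Y f \<and> f ` X = Y"

text \<open>
  Maps between the balls around \<open>x\<close> and \<open>y\<close> are maps of pointed balls: they send the centre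
  \<open>x\<close> to the centre \<open>y\<close>. Without this, in a space of finite diameter the identity on a ball of
  large radius would relate any two points.
\<close>

definition hom_equivalent :: "'a::metric_space \<Rightarrow> 'a \<Rightarrow> bool" where
  "hom_equivalent x y \<longleftrightarrow>
     (\<exists>\<epsilon>>0. \<exists>f. isometry_between (ball x \<epsilon>) (ball y \<epsilon>) f \<and> f x = y)"

definition hom_le :: "'a::metric_space \<Rightarrow> 'a \<Rightarrow> bool" where
  "hom_le x y \<longleftrightarrow>
     (\<exists>\<epsilon>>0. \<exists>f. isometric_map (ball x \<epsilon>) (ball y \<epsilon>) f \<and> f x = y)"

definition hom_maximal :: "'a::metric_space \<Rightarrow> bool" where
  "hom_maximal x \<longleftrightarrow> (\<forall>y. hom_le x y \<longrightarrow> hom_le y x)"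

definition hom_components :: "('a::metric_space) set set" where
  "hom_components = UNIV // {(x, y). hom_equivalent x y}"

definition hom_component_le :: "('a::metric_space) set \<Rightarrow> 'a set \<Rightarrow> bool" where
  "hom_component_le C D \<longleftrightarrow> (\<forall>x\<in>C. \<forall>y\<in>D. hom_le x y)"

definition greatest_hom_component :: "('a::metric_space) set \<Rightarrow> bool" where
  "greatest_hom_component C \<longleftrightarrow>
     C \<in> hom_components \<and> (\<forall>D\<in>hom_components. hom_component_le D C)"

definition strongly_isometrically_compatible :: "('a::metric_space) measure \<Rightarrow> bool" where
  "strongly_isometrically_compatible m \<longleftrightarrow>
     sets m = sets borel \<and>
     (\<forall>U V f. open U \<longrightarrow> open V \<longrightarrow> isometric_map U V f \<longrightarrow> emeasure m (f ` U) = emeasure m U)"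

end

theory Submission
  imports Defs
begin

text \<open>
  A Baire category argument produces a ball \<open>ball y0 s\<close> all of whose points have isometric pointed
  \<open>s\<close>-balls, and every point of the space has a neighbourhood embedding isometrically into
  it; such an embedding is called a chart.

  Existence. Normalised covering numbers by sets of small diameter give, after passing to a cluster
  point, a content that is invariant under isometries of arbitrary sets; its regularisation is a Borel
  measure \<open>M\<close> invariant under isometries between open sets. The regularisation need not be
  invariant under non-open isometric maps, and on the complement of the greatest component it can be
  wrong. The key step is that compact isometric subsets \<open>A\<close>, \<open>B\<close> of
  \<open>ball y0 s\<close> have equal measure: choose a set of diameter below \<open>r\<close> whose
  measure nearly attains the supremum \<open>\<mu>\<close> over all such sets, and let a random copy
  \<open>T\<close> of it move over the space. By homogeneity all points are covered by \<open>T\<close>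
  with the same weight, every slice of \<open>B\<close> corresponding to \<open>A \<inter> T\<close> has
  measure at most \<open>\<mu>\<close>, and \<open>T\<close> stays in the \<open>r\<close>-neighbourhood of
  \<open>A\<close> if it meets \<open>A\<close>; by Fubini \<open>B\<close> has at most the measure of that
  neighbourhood. Pulling \<open>M\<close> back along charts therefore gives a well defined measure on the
  whole space, which is strongly isometrically compatible.

  Uniqueness. Two compatible measures give the same mass to all small balls of equal radius in
  \<open>ball y0 s\<close>, so Christensen's double counting of pairs at distance below \<open>r\<close>
  makes them proportional there, and charts carry this over to the whole space.
\<close>

section \<open>Isometric maps and uniform local homogeneity\<close>

text \<open>Unlike \<open>isometric_map\<close> this fixes no target set, so that restricting and
  inverting a map need no choice of codomain.\<close>

definition isometric_on :: "('a::metric_space) set \<Rightarrow> ('a \<Rightarrow> 'b::metric_space) \<Rightarrow> bool" where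
  "isometric_on X f \<longleftrightarrow> (\<forall>x\<in>X. \<forall>y\<in>X. dist (f x) (f y) = dist x y)"

lemma isometric_onD: "isometric_on X f \<Longrightarrow> x \<in> X \<Longrightarrow> y \<in> X \<Longrightarrow> dist (f x) (f y) = dist x y"
  by (simp add: isometric_on_def)

lemma isometric_on_subset: "isometric_on X f \<Longrightarrow> Y \<subseteq> X \<Longrightarrow> isometric_on Y f"
  by (auto simp: isometric_on_def)

lemma isometric_on_inj: "isometric_on X f \<Longrightarrow> inj_on f X"
proof (rule inj_onI)
  fix x y assume "isometric_on X f" "x \<in> X" "y \<in> X" "f x = f y"
  then show "x = y" using isometric_onD[of X f x y] by simp
qed

lemma isometric_on_continuous: "isometric_on X f \<Longrightarrow> continuous_on X f"
  by (fastforce simp: isometric_on_def continuous_on_iff)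

lemma isometric_on_inv: "isometric_on X f \<Longrightarrow> isometric_on (f ` X) (inv_into X f)"
  by (auto simp: isometric_on_def isometric_on_inj inv_into_f_f)

lemma isometric_on_comp:
  "isometric_on X f \<Longrightarrow> isometric_on (f ` X) g \<Longrightarrow> isometric_on X (\<lambda>x. g (f x))"
  by (auto simp: isometric_on_def)

lemma compact_isometric_image: "isometric_on X f \<Longrightarrow> compact X \<Longrightarrow> compact (f ` X)"
  using compact_continuous_image isometric_on_continuous by blast

lemma isometric_on_ball_image:
  "isometric_on (ball a r) f \<Longrightarrow> t \<le> r \<Longrightarrow> f ` ball a t \<subseteq> ball (f a) t"
proof -
  assume *: "isometric_on (ball a r) f" "t \<le> r"
  have "dist (f a) (f x) < t" if "dist a x < t" for x
    using isometric_onD[OF *(1), of a x] that *(2) zero_le_dist[of a x] by (simp del: zero_le_dist)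
  then show ?thesis by auto
qed

lemma isometry_between_iff: "isometry_between X Y f \<longleftrightarrow> isometric_on X f \<and> f ` X = Y"
  by (auto simp: isometry_between_def isometric_map_def isometric_on_def)

text \<open>A poor man's ultrafilter: a single filter along which all coordinates converge.\<close>

lemma pointwise_cluster_filter:
  fixes X :: "nat \<Rightarrow> 'b \<Rightarrow> 'c::topological_space"
  assumes S: "compact S" and X: "\<And>k u. X k u \<in> S"
  shows "\<exists>f G. G \<noteq> bot \<and> G \<le> sequentially \<and>
    (\<forall>u. f u \<in> S) \<and> (\<forall>u. ((\<lambda>k. X k u) \<longlongrightarrow> f u) G)"
proof -
  \<comment> \<open>By Tychonoff's theorem the space of all functions with values in
    \<open>S\<close> is compact, so the sequence \<open>X\<close> of functions has a cluster point
    \<open>f\<close>.\<close>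
  define P where "P = (PiE UNIV (\<lambda>_::'b. S))"
  have "compact P"
    using compactin_PiE[of "\<lambda>_. euclidean" UNIV "\<lambda>_::'b. S"] S
    by (simp add: P_def euclidean_product_topology)
  moreover have "filtermap X sequentially \<noteq> bot"
    by (simp add: filtermap_bot_iff)
  moreover have "eventually (\<lambda>h. h \<in> P) (filtermap X sequentially)"
    using X by (auto simp: eventually_filtermap P_def PiE_def Pi_def extensional_def)
  ultimately obtain f where f: "f \<in> P" "inf (nhds f) (filtermap X sequentially) \<noteq> bot"
    unfolding compact_filter by blast
  \<comment> \<open>The pulled-back neighbourhoods of the cluster point make \<open>X\<close>
    converge along \<open>G\<close>; the infimum with \<open>sequentially\<close> keeps every
    eventual statement true along \<open>G\<close>.\<close>
  define G where "G = inf (filtercomap X (nhds f)) sequentially"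
  have "G \<noteq> bot"
  proof
    assume "G = bot"
    then have "eventually (\<lambda>_. False) G" by simp
    then obtain Q R where Q: "eventually Q (filtercomap X (nhds f))" and R: "eventually R sequentially"
      and QR: "\<And>k. Q k \<Longrightarrow> R k \<Longrightarrow> False"
      unfolding G_def eventually_inf by blast
    obtain Q' where Q': "eventually Q' (nhds f)" "\<And>k. Q' (X k) \<Longrightarrow> Q k"
      using Q unfolding eventually_filtercomap by blast
    have "eventually (\<lambda>h. \<exists>k. h = X k \<and> R k) (filtermap X sequentially)"
      unfolding eventually_filtermap using R by eventually_elim auto
    with Q'(1) have "eventually (\<lambda>_. False) (inf (nhds f) (filtermap X sequentially))"
      unfolding eventually_inf using Q'(2) QR
      by (intro exI[of _ Q'] exI[of _ "\<lambda>h. \<exists>k. h = X k \<and> R k"]) auto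
    with f(2) show False by (simp add: eventually_False)
  qed
  moreover have "((\<lambda>k. X k u) \<longlongrightarrow> f u) G" for u
  proof -
    have "filterlim X (nhds f) G"
      by (simp add: G_def filterlim_iff_le_filtercomap)
    then show ?thesis
      using continuous_on_tendsto_compose[OF continuous_on_product_coordinates[of u], of X f G] by simp
  qed
  moreover have "G \<le> sequentially" by (simp add: G_def)
  moreover have "f u \<in> S" for u using f(1) by (auto simp: P_def PiE_def Pi_def)
  ultimately show ?thesis by blast
qed

text \<open>A point \<open>x\<close> outside the image has positive distance \<open>d\<close> to it,
  so any two members of its orbit under \<open>f\<close> are at distance at least \<open>d\<close>,
  and no subsequence of the orbit can be Cauchy. This is how opposite embeddings of balls are later
  seen to be onto.\<close>

lemma compact_isometric_self_map_onto:
  fixes S :: "'a::metric_space set"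
  assumes S: "compact S" and f: "isometric_on S f" "f ` S \<subseteq> S"
  shows "f ` S = S"
proof (rule ccontr)
  assume "f ` S \<noteq> S"
  then obtain x where x: "x \<in> S" "x \<notin> f ` S" using f by blast
  have "closed (f ` S)"
    by (intro compact_imp_closed compact_isometric_image S f)
  then obtain d where d0: "d > 0" "ball x d \<subseteq> - f ` S"
    using x(2) unfolding closed_def by (meson ComplI openE)
  have d: "d > 0" "\<And>y. y \<in> f ` S \<Longrightarrow> dist x y \<ge> d"
    using d0 by (auto simp: subset_iff not_less[symmetric])
  define X where "X = (\<lambda>n. (f ^^ n) x)"
  have XS: "X n \<in> S" for n by (induction n) (use x f in \<open>auto simp: X_def\<close>)
  have Xiso: "dist (X (n + m)) (X (n + k)) = dist (X m) (X k)" for n m k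
  proof (induction n)
    case (Suc n)
    have "dist (f (X (n + m))) (f (X (n + k))) = dist (X (n + m)) (X (n + k))"
      using XS f by (simp add: isometric_on_def)
    with Suc show ?case by (simp add: X_def)
  qed simp
  have far: "dist (X n) (X m) \<ge> d" if "n < m" for n m
  proof -
    obtain k where k: "m = n + Suc k" using less_imp_Suc_add[OF \<open>n < m\<close>] by auto
    \<comment> \<open>Cancelling the first \<open>n\<close> iterates compares \<open>x\<close>
      itself with a point of the image.\<close>
    have "dist (X n) (X m) = dist (X 0) (X (Suc k))"
      using Xiso[of n 0 "Suc k"] by (simp add: k)
    moreover have "X (Suc k) \<in> f ` S" using XS[of k] by (simp add: X_def)
    ultimately show ?thesis using d(2) by (simp add: X_def)
  qed
  obtain l r where "strict_mono r" and lim: "(X \<circ> r) \<longlonglongrightarrow> l"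
    using S[unfolded compact_def, rule_format, of X] XS by blast
  then have "Cauchy (X \<circ> r)" by (simp add: LIMSEQ_imp_Cauchy)
  then obtain N where "\<And>m n. m \<ge> N \<Longrightarrow> n \<ge> N \<Longrightarrow> dist ((X \<circ> r) m) ((X \<circ> r) n) < d"
    using d(1) unfolding Cauchy_def by blast
  then have "dist (X (r N)) (X (r (Suc N))) < d" by simp
  moreover have "r N < r (Suc N)" using \<open>strict_mono r\<close> by (simp add: strict_mono_def)
  ultimately show False using far[of "r N" "r (Suc N)"] by simp
qed

section \<open>Pointed embeddings of balls with explicit radius\<close>

definition pointed_embedding :: "real \<Rightarrow> 'a::metric_space \<Rightarrow> 'a \<Rightarrow> bool" where
  "pointed_embedding r a b \<longleftrightarrow> (\<exists>f. isometric_on (ball a r) f \<and> f a = b)"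

lemma pointed_embeddingI: "isometric_on (ball a r) f \<Longrightarrow> f a = b \<Longrightarrow> pointed_embedding r a b"
  unfolding pointed_embedding_def by (intro exI conjI)

lemma pointed_embeddingE:
  assumes "pointed_embedding r a b"
  obtains f where "isometric_on (ball a r) f" "f a = b"
  using assms unfolding pointed_embedding_def by (elim exE conjE)

lemma pointed_embedding_mono:
  assumes "pointed_embedding r a b" "t \<le> r"
  shows "pointed_embedding t a b"
proof -
  obtain f where f: "isometric_on (ball a r) f" "f a = b"
    using assms(1) by (rule pointed_embeddingE)
  show ?thesis
    by (rule pointed_embeddingI[OF isometric_on_subset[OF f(1) subset_ball[OF assms(2)]] f(2)])
qed

lemma pointed_embedding_trans:
  assumes "pointed_embedding r a b" "pointed_embedding r b c"
  shows "pointed_embedding r a c"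
proof -
  obtain f where f: "isometric_on (ball a r) f" "f a = b"
    using assms(1) by (rule pointed_embeddingE)
  obtain g where g: "isometric_on (ball b r) g" "g b = c"
    using assms(2) by (rule pointed_embeddingE)
  have "f ` ball a r \<subseteq> ball b r"
    using isometric_on_ball_image[OF f(1) order_refl] by (simp only: f(2))
  then have "isometric_on (ball a r) (\<lambda>x. g (f x))"
    by (rule isometric_on_comp[OF f(1) isometric_on_subset[OF g(1)]])
  then show ?thesis by (rule pointed_embeddingI) (simp only: f g)
qed

text \<open>An isometric map sends the ball around \<open>x\<close> into the ball of the same radius
  around its image, so the range condition in \<open>hom_le\<close> is automatic. Naming the radius
  lets the Baire argument look for one radius that serves many points.\<close>

lemma hom_le_iff: "hom_le x y \<longleftrightarrow> (\<exists>r>0. pointed_embedding r x y)"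
proof -
  have "isometric_map (ball x r) (ball y r) f \<and> f x = y \<longleftrightarrow> isometric_on (ball x r) f \<and> f x = y" for r f
  proof (cases "f x = y")
    case True
    then show ?thesis
      using isometric_on_ball_image[of x r f r] unfolding isometric_map_def isometric_on_def by (simp only: order_refl) blast
  qed simp
  then show ?thesis by (simp only: hom_le_def pointed_embedding_def)
qed

text \<open>A cluster point of the embeddings is an embedding: each point of \<open>ball a r\<close>
  eventually lies in \<open>ball (A k) r\<close>, and equalities of distances pass to the limit.
  This makes the sets in the Baire argument closed.\<close>

lemma pointed_embedding_closed:
  fixes a b :: "'a::metric_space"
  assumes K: "compact (UNIV :: 'a set)"
    and a: "A \<longlonglongrightarrow> a" and b: "B \<longlonglongrightarrow> b"
    and emb: "\<And>k. pointed_embedding r (A k) (B k)" and r: "r > 0"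
  shows "pointed_embedding r a b"
proof -
  obtain F where F: "\<And>k. isometric_on (ball (A k) r) (F k)" "\<And>k. F k (A k) = B k"
    using emb unfolding pointed_embedding_def by metis
  obtain f G where G: "G \<noteq> bot" "G \<le> sequentially" and f: "\<And>u. ((\<lambda>k. F k u) \<longlongrightarrow> f u) G"
    using pointwise_cluster_filter[OF K, of F, OF UNIV_I] by blast
  have ev: "eventually (\<lambda>k. u \<in> ball (A k) r) G" if "u \<in> ball a r" for u
  proof -
    have "(\<lambda>k. dist (A k) u) \<longlonglongrightarrow> dist a u" using a by (intro tendsto_intros)
    then have "eventually (\<lambda>k. dist (A k) u < r) sequentially"
      using that by (intro order_tendstoD(2)[of _ "dist a u"]) auto
    then have "eventually (\<lambda>k. dist (A k) u < r) G" using G(2) by (rule filter_leD[rotated])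
    then show ?thesis by simp
  qed
  have "isometric_on (ball a r) f"
    unfolding isometric_on_def
  proof (intro ballI)
    fix u v assume that: "u \<in> ball a r" "v \<in> ball a r"
    show "dist (f u) (f v) = dist u v"
    proof (rule tendsto_unique[OF G(1)])
      show "((\<lambda>k. dist (F k u) (F k v)) \<longlongrightarrow> dist (f u) (f v)) G" by (intro tendsto_intros f)
      have "eventually (\<lambda>k. dist (F k u) (F k v) = dist u v) G"
        using ev[OF that(1)] ev[OF that(2)]
        by eventually_elim (rule isometric_onD[OF F(1)])
      then show "((\<lambda>k. dist (F k u) (F k v)) \<longlongrightarrow> dist u v) G"
        by (rule tendsto_eventually)
    qed
  qed
  moreover have "f a = b"
  proof -
    have "((\<lambda>k. dist (F k a) (B k)) \<longlongrightarrow> dist (f a) b) G"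
      by (intro tendsto_intros f tendsto_mono[OF G(2) b])
    \<comment> \<open>Since \<open>B k = F k (A k)\<close>, this distance equals
      \<open>dist a (A k)\<close> as soon as \<open>a\<close> lies in the moving ball.\<close>
    moreover have "((\<lambda>k. dist (F k a) (B k)) \<longlongrightarrow> 0) G"
    proof -
      have "((\<lambda>k. dist a (A k)) \<longlongrightarrow> dist a a) G"
        by (intro tendsto_intros tendsto_mono[OF G(2) a])
      moreover have "eventually (\<lambda>k. dist a (A k) = dist (F k a) (B k)) G"
        using ev[OF centre_in_ball[THEN iffD2, OF r]]
        by eventually_elim (use isometric_onD[OF F(1)] F(2)[symmetric] r in \<open>simp add: dist_commute\<close>)
      ultimately have "((\<lambda>k. dist (F k a) (B k)) \<longlongrightarrow> dist a a) G" by (rule Lim_transform_eventually)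
      then show ?thesis by simp
    qed
    ultimately have "dist (f a) b = 0" by (rule tendsto_unique[OF G(1)])
    then show ?thesis by simp
  qed
  ultimately show ?thesis unfolding pointed_embedding_def by (intro exI[of _ f] conjI)
qed

text \<open>The composition of the two embeddings is a self-map of a compact ball, hence onto.\<close>

lemma mutual_pointed_embeddings_onto:
  fixes a b :: "'a::metric_space"
  assumes K: "compact (UNIV :: 'a set)"
    and "pointed_embedding r a b" "pointed_embedding r b a" "s < r"
  obtains f where "isometry_between (ball a s) (ball b s) f" "f a = b"
proof -
  obtain f where f: "isometric_on (ball a r) f" "f a = b"
    using assms(2) by (rule pointed_embeddingE)
  obtain g where g: "isometric_on (ball b r) g" "g b = a"
    using assms(3) by (rule pointed_embeddingE)
  have "f ` ball a s = ball b s"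
  proof
    show "f ` ball a s \<subseteq> ball b s" using isometric_on_ball_image[OF f(1), of s] assms(4) f(2) by simp
    show "ball b s \<subseteq> f ` ball a s"
    proof
      fix p assume p: "p \<in> ball b s"
      \<comment> \<open>The closed balls of radius \<open>d\<close> are compact, one of them
        contains \<open>p\<close>, and they lie in the domains of the embeddings because
        \<open>d < s < r\<close>.\<close>
      define d where "d = dist b p"
      have d: "d < s" "0 \<le> d" using p by (auto simp: d_def)
      have fim: "f u \<in> cball b d" if "u \<in> cball a d" for u
        using that d assms(4) f isometric_onD[OF f(1), of a u] by (auto simp: dist_commute)
      have gim: "g v \<in> cball a d" if "v \<in> cball b d" for v
        using that d assms(4) g isometric_onD[OF g(1), of b v] by (auto simp: dist_commute)
      have sub: "cball a d \<subseteq> ball a r" "cball b d \<subseteq> ball b r" using d assms(4) by auto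
      have "isometric_on (cball a d) (\<lambda>u. g (f u))"
      proof (rule isometric_on_comp[of _ f g])
        show "isometric_on (cball a d) f" using isometric_on_subset[OF f(1) sub(1)] .
        have "f ` cball a d \<subseteq> ball b r" using fim sub(2) by blast
        then show "isometric_on (f ` cball a d) g" using isometric_on_subset[OF g(1)] by blast
      qed
      moreover have "compact (cball a d)"
        using K compact_Int_closed[of UNIV "cball a d"] by simp
      ultimately have "(\<lambda>u. g (f u)) ` cball a d = cball a d"
        by (intro compact_isometric_self_map_onto) (use fim gim in auto)
      moreover have pb: "p \<in> cball b d" by (simp add: d_def)
      ultimately obtain u where u: "u \<in> cball a d" "g (f u) = g p" using gim by (metis imageE)
      have "f u = p"
        
        using inj_onD[OF isometric_on_inj[OF g(1)] u(2)] fim[OF u(1)] pb sub(2) by blast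
      then show "p \<in> f ` ball a s" using u d by auto
    qed
  qed
  moreover have "isometric_on (ball a s) f" 
    using isometric_on_subset[OF f(1) subset_ball] assms(4) by simp
  ultimately have "isometry_between (ball a s) (ball b s) f" by (simp add: isometry_between_iff)
  then show thesis using f(2) by (rule that)
qed

lemma hom_equivalent_pointed_embedding:
  assumes "hom_equivalent x y"
  obtains r where "r > 0" "pointed_embedding r x y" "pointed_embedding r y x"
proof -
  obtain r f where r: "r > 0" and f: "isometric_on (ball x r) f" "f ` ball x r = ball y r" "f x = y"
    using assms by (auto simp: hom_equivalent_def isometry_between_iff)
  have "isometric_on (ball y r) (inv_into (ball x r) f)" using isometric_on_inv[OF f(1)] f(2) by simp
  moreover have "inv_into (ball x r) f y = x"
    using inv_into_f_f[OF isometric_on_inj[OF f(1)], of x] f(3) r by simp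
  ultimately have "pointed_embedding r y x" unfolding pointed_embedding_def by (intro exI conjI)
  moreover have "pointed_embedding r x y" unfolding pointed_embedding_def using f(1,3) by (intro exI conjI)
  ultimately show thesis using that[OF r] by simp
qed

text \<open>Compactness turns two opposite embeddings into an isometry onto, at the cost of halving
  the radius.\<close>

lemma hom_equivalent_iff:
  fixes x y :: "'a::metric_space"
  assumes "compact (UNIV :: 'a set)"
  shows "hom_equivalent x y \<longleftrightarrow> (\<exists>r>0. pointed_embedding r x y \<and> pointed_embedding r y x)"
proof
  show "hom_equivalent x y \<Longrightarrow> \<exists>r>0. pointed_embedding r x y \<and> pointed_embedding r y x"
    using hom_equivalent_pointed_embedding[of x y] by blast
  assume "\<exists>r>0. pointed_embedding r x y \<and> pointed_embedding r y x"
  then obtain r where r: "r > 0" "pointed_embedding r x y" "pointed_embedding r y x" by blast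
  then obtain f where "isometry_between (ball x (r/2)) (ball y (r/2)) f \<and> f x = y"
    using mutual_pointed_embeddings_onto[OF assms, of r x y "r/2"] by (metis field_sum_of_halves less_add_same_cancel1 half_gt_zero)
  then have "\<exists>f. isometry_between (ball x (r/2)) (ball y (r/2)) f \<and> f x = y" by (rule exI[of _ f])
  then show "hom_equivalent x y" unfolding hom_equivalent_def using r(1) by (intro exI[of _ "r/2"] conjI) simp_all
qed

section \<open>Homogeneous components and a uniformly homogeneous ball\<close>

lemma hom_equivalent_refl: "hom_equivalent x x"
  unfolding hom_equivalent_def isometry_between_iff
  by (intro exI[of _ "1::real"] exI[of _ "\<lambda>x. x"]) (auto simp: isometric_on_def)

lemma hom_equivalent_sym:
  assumes K: "compact (UNIV :: 'a::metric_space set)" and "hom_equivalent x (y::'a)"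
  shows "hom_equivalent y x"
  using assms(2) unfolding hom_equivalent_iff[OF K] by blast

lemma hom_equivalent_trans:
  assumes K: "compact (UNIV :: 'a::metric_space set)"
    and "hom_equivalent x (y::'a)" "hom_equivalent y z"
  shows "hom_equivalent x z"
proof -
  obtain r t where "0 < r" "pointed_embedding r x y" "pointed_embedding r y x"
       "0 < t" "pointed_embedding t y z" "pointed_embedding t z y"
    using assms(2,3) unfolding hom_equivalent_iff[OF K] by blast
  then have "pointed_embedding (min r t) x y" "pointed_embedding (min r t) y x"
     "pointed_embedding (min r t) y z" "pointed_embedding (min r t) z y" "0 < min r t"
    using pointed_embedding_mono[of r _ _ "min r t"] pointed_embedding_mono[of t _ _ "min r t"]
    by simp_all
  then have "0 < min r t \<and> pointed_embedding (min r t) x z \<and> pointed_embedding (min r t) z x"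
    using pointed_embedding_trans[of "min r t" x y z] pointed_embedding_trans[of "min r t" z y x] by simp
  then show ?thesis unfolding hom_equivalent_iff[OF K] by blast
qed

lemma hom_component_mem_iff:
  assumes K: "compact (UNIV :: 'a::metric_space set)"
    and C: "C \<in> hom_components" and x: "(x::'a) \<in> C"
  shows "y \<in> C \<longleftrightarrow> hom_equivalent x y"
proof -
  obtain a where "C = {y. hom_equivalent a y}"
    using C unfolding hom_components_def by (auto elim!: quotientE)
  then show ?thesis using x hom_equivalent_sym[OF K] hom_equivalent_trans[OF K] by blast
qed

text \<open>Every point \<open>y\<close> of the component is carried to an interior point
  \<open>x\<close> by a local isometry. Points near \<open>y\<close> are then carried into the
  component, and the same map shows that they are equivalent to their images.\<close>

lemma hom_component_open:
  assumes K: "compact (UNIV :: 'a::metric_space set)"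
    and C: "C \<in> hom_components" "interior C \<noteq> ({} :: 'a set)"
  shows "open C"
proof -
  note mem = hom_component_mem_iff[OF K C(1)]
  obtain x t where x: "t > 0" "ball x t \<subseteq> C"
    using C(2) by (metis equals0I mem_interior)
  then have xC: "x \<in> C" by (auto)
  show ?thesis unfolding open_contains_ball
  proof
    fix y assume "y \<in> C"
    then have "hom_equivalent y x"
      using mem xC by blast
    then obtain r f where r: "r > 0" and f: "isometric_on (ball y r) f" "f ` ball y r = ball x r" "f y = x"
      by (auto simp: hom_equivalent_def isometry_between_iff)
    \<comment> \<open>Halving leaves room for \<open>ball z d\<close> inside \<open>ball y r\<close>
      when \<open>z\<close> is within \<open>d\<close> of \<open>y\<close>, and likewise for
      \<open>ball (f z) d\<close> inside \<open>ball x r\<close>.\<close>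
    define d where "d = min r t / 2"
    have d: "d > 0" "2 * d \<le> r" "2 * d \<le> t" using r x by (auto simp: d_def)
    have "z \<in> C" if z: "z \<in> ball y d" for z
    proof -
      have sub: "ball z d \<subseteq> ball y r"
      proof
        fix v assume "v \<in> ball z d" then show "v \<in> ball y r"
          using z d dist_triangle[of y v z] by auto
      qed
      have dfz: "dist x (f z) < d" using f z r d isometric_onD[OF f(1), of y z] by auto
      have "f ` ball z d = ball (f z) d"
      proof
        show "f ` ball z d \<subseteq> ball (f z) d"
          using isometric_on_ball_image isometric_on_subset[OF f(1) sub] by (metis order_refl)
        show "ball (f z) d \<subseteq> f ` ball z d"
        proof
          fix v assume v: "v \<in> ball (f z) d"
          then have "v \<in> ball x r" using dfz d dist_triangle[of x v "f z"] by auto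
          then obtain u where u: "u \<in> ball y r" "f u = v" using f(2) by (metis imageE)
          then have "dist z u = dist (f z) (f u)"
            using isometric_onD[OF f(1), of z u] z d by auto
          then show "v \<in> f ` ball z d" using u v by auto
        qed
      qed
      then have "hom_equivalent z (f z)"
        unfolding hom_equivalent_def isometry_between_iff
        using isometric_on_subset[OF f(1) sub] d by blast
      moreover have "f z \<in> C" using dfz d x by (auto simp: subset_iff)
      ultimately show "z \<in> C" using mem hom_equivalent_sym[OF K] by blast
    qed
    then show "\<exists>e>0. ball y e \<subseteq> C" using d by blast
  qed
qed

text \<open>Baire category: the points joined to \<open>y\<close> by embeddings in both directions
  at radius \<open>1 / Suc n\<close> form closed sets \<open>E n\<close> that cover a closed ball
  inside \<open>Km\<close>, so one of them has interior. Any two points of that \<open>E n\<close>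
  embed into each other through \<open>y\<close> at the same radius.\<close>

lemma greatest_hom_component_core:
  fixes Km :: "'a::metric_space set"
  assumes K: "compact (UNIV :: 'a set)"
    and Km: "greatest_hom_component Km" and int: "interior Km \<noteq> {}"
  obtains y0 :: 'a and s where "s > 0"
    "\<And>z. z \<in> ball y0 s \<Longrightarrow> \<exists>f. isometry_between (ball z s) (ball y0 s) f \<and> f z = y0"
    "\<And>x. hom_le x y0"
proof -
  have KmC: "Km \<in> hom_components" using Km by (simp add: greatest_hom_component_def)
  have opn: "open Km" using hom_component_open[OF K KmC int] .
  have eqv: "hom_equivalent x y" if "x \<in> Km" "y \<in> Km" for x y
    using hom_component_mem_iff[OF K KmC] that by blast
  have le: "hom_le x y" if "y \<in> Km" for x y
  proof -
    have "{(x::'a, y). hom_equivalent x y} `` {x} \<in> hom_components"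
      unfolding hom_components_def by (rule quotientI) simp
    then have "hom_component_le ({(x::'a, y). hom_equivalent x y} `` {x}) Km"
      using Km by (simp add: greatest_hom_component_def)
    moreover have "x \<in> {(x::'a, y). hom_equivalent x y} `` {x}"
      by (simp add: hom_equivalent_refl)
    ultimately show ?thesis using that unfolding hom_component_le_def by blast
  qed
  obtain y e where y: "y \<in> Km" and e: "e > 0" "cball y e \<subseteq> Km"
    using opn int interior_subset open_contains_cball by (metis equals0I subsetD)
  define E where "E n = {z. pointed_embedding (1 / real (Suc n)) y z \<and> pointed_embedding (1 / real (Suc n)) z y}" for n
  have Ecl: "closed (E n)" for n
    unfolding closed_sequential_limits
  proof (intro allI impI)
    fix x l assume "(\<forall>k. x k \<in> E n) \<and> x \<longlonglongrightarrow> l"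
    then show "l \<in> E n"
      using pointed_embedding_closed[OF K _ _ , of x l "\<lambda>_. y" y "1 / real (Suc n)"]
        pointed_embedding_closed[OF K _ _ , of "\<lambda>_. y" y x l "1 / real (Suc n)"]
      by (auto simp: E_def)
  qed
  have cov: "cball y e \<subseteq> (\<Union>n. E n)"
  proof
    fix z assume "z \<in> cball y e"
    then have "hom_equivalent y z" using eqv y e by blast
    then obtain r where r: "r > 0" "pointed_embedding r y z" "pointed_embedding r z y"
      by (rule hom_equivalent_pointed_embedding)
    obtain n where n: "1 / real (Suc n) < r" by (rule nat_approx_posE[OF r(1)])
    have "z \<in> E n"
      unfolding E_def using n r(2,3)[THEN pointed_embedding_mono, OF less_imp_le[OF n]] by simp
    then show "z \<in> (\<Union>n. E n)" by blast
  qed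
  have "\<exists>n. interior (E n \<inter> cball y e) \<noteq> {}"
  proof (rule ccontr)
    assume "\<nexists>n. interior (E n \<inter> cball y e) \<noteq> {}"
    then have *: "\<And>T. T \<in> range (\<lambda>n. E n \<inter> cball y e) \<Longrightarrow>
        closedin Met_TC.mtopology T \<and> Met_TC.mtopology interior_of T = {}"
      using Ecl closed_cball closed_Int by (force simp del: interior_Int)
    have "interior (\<Union>(range (\<lambda>n. E n \<inter> cball y e))) = {}"
      using Met_TC.metric_Baire_category_alt[OF _ _ *, of "range (\<lambda>n. E n \<inter> cball y e)"]
        compact_imp_complete[OF K]
      by (simp add: mcomplete_iff_complete del: interior_Int UN_simps)
    moreover have "ball y e \<subseteq> \<Union>(range (\<lambda>n. E n \<inter> cball y e))"
      using cov ball_subset_cball[of y e] by blast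
    ultimately have "ball y e = {}"
      using interior_maximal[OF _ open_ball, of y e "\<Union>(range (\<lambda>n. E n \<inter> cball y e))"] by simp
    then show False using e(1) by simp
  qed
  then obtain n y1 where y1: "y1 \<in> interior (E n \<inter> cball y e)" by blast
  then obtain t where t: "t > 0" "ball y1 t \<subseteq> E n \<inter> cball y e" by (meson mem_interior)
  \<comment> \<open>Strictly below \<open>1 / Suc n\<close>, since
    \<open>mutual_pointed_embeddings_onto\<close> needs a smaller radius, and below
    \<open>t\<close>, so that the ball stays in \<open>E n\<close>.\<close>
  define s where "s = min t (1 / real (Suc n)) / 2"
  have s: "s > 0" "s < t" "s < 1 / real (Suc n)" 
  proof -
    have "min x z / 2 > 0" "min x z / 2 < x" "min x z / 2 < z" if "x > 0" "z > 0" for x z :: real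
      using that by (auto simp: min_def)
    then show "s > 0" "s < t" "s < 1 / real (Suc n)" 
      unfolding s_def using t(1) by (metis divide_pos_pos of_nat_0_less_iff zero_less_Suc zero_less_one)+
  qed
  show thesis
  proof (rule that)
    show "s > 0" by fact
    have "y1 \<in> Km" using y1 interior_subset e by blast
    then show "hom_le x y1" for x using le by blast
    have y1E: "y1 \<in> E n" using t by (auto simp: subset_iff)
    fix z assume "z \<in> ball y1 s"
    then have "z \<in> ball y1 t" using s by auto
    then have zE: "z \<in> E n" using t by blast
    have "pointed_embedding (1 / real (Suc n)) z y1" "pointed_embedding (1 / real (Suc n)) y1 z"
      using zE y1E pointed_embedding_trans[of "1 / real (Suc n)" z y y1]
        pointed_embedding_trans[of "1 / real (Suc n)" y1 y z]
      unfolding E_def by simp_all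
    from mutual_pointed_embeddings_onto[OF K this s(3)]
    obtain f where "isometry_between (ball z s) (ball y1 s) f" "f z = y1" .
    then show "\<exists>f. isometry_between (ball z s) (ball y1 s) f \<and> f z = y1" by (intro exI conjI)
  qed
qed

section \<open>An isometric content and its Borel measure\<close>

text \<open>The covering sets are arbitrary, not balls, so the number of sets needed depends only on
  the metric of \<open>A\<close> and not on the surrounding space. The strict bound keeps points at
  distance at least \<open>e\<close> in different sets.\<close>

definition cover_mesh :: "real \<Rightarrow> 'a::metric_space set \<Rightarrow> 'a set set \<Rightarrow> bool" where
  "cover_mesh e A F \<longleftrightarrow> finite F \<and> A \<subseteq> \<Union>F \<and> (\<forall>T\<in>F. \<forall>u\<in>T. \<forall>v\<in>T. dist u v < e)"

definition covering_number :: "real \<Rightarrow> 'a::metric_space set \<Rightarrow> nat" where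
  "covering_number e A = (LEAST n. \<exists>F. cover_mesh e A F \<and> card F = n)"

lemma cover_mesh_subset:
  assumes "cover_mesh e B F" "G \<subseteq> F" "A \<subseteq> \<Union>G"
  shows "cover_mesh e A G"
  unfolding cover_mesh_def
proof (intro conjI ballI)
  show "finite G" using assms finite_subset by (auto simp: cover_mesh_def)
  show "A \<subseteq> \<Union>G" by fact
  fix T u v assume T: "T \<in> G" "u \<in> T" "v \<in> T"
  have "\<forall>T\<in>F. \<forall>u\<in>T. \<forall>v\<in>T. dist u v < e" using assms(1) by (simp add: cover_mesh_def)
  from this[rule_format, OF subsetD[OF assms(2) T(1)] T(2,3)] show "dist u v < e" .
qed

lemma cover_mesh_exists:
  fixes A :: "'a::metric_space set"
  assumes K: "compact (UNIV :: 'a set)" and e: "e > 0"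
  shows "\<exists>F. cover_mesh e A F"
proof -
  have "e / 2 > 0" using e by simp
  with seq_compact_imp_totally_bounded[OF compact_imp_seq_compact[OF K]]
  obtain k :: "'a set" where k: "finite k" "UNIV \<subseteq> (\<Union>x\<in>k. ball x (e/2))" by blast
  have "dist u v < e" if "u \<in> ball x (e/2)" "v \<in> ball x (e/2)" for u v x :: 'a
    using that dist_triangle2[of u v x] by (simp add: dist_commute)
  then have "cover_mesh e A ((\<lambda>x. ball x (e/2)) ` k)"
    using k unfolding cover_mesh_def by auto
  then show ?thesis by (rule exI)
qed

lemma covering_number_attained:
  fixes A :: "'a::metric_space set"
  assumes "compact (UNIV :: 'a set)" "e > 0"
  shows "\<exists>F. cover_mesh e A F \<and> card F = covering_number e A"
proof -
  obtain F where "cover_mesh e A F" using cover_mesh_exists[OF assms] ..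
  then have "\<exists>n. \<exists>F. cover_mesh e A F \<and> card F = n" by auto
  then show ?thesis unfolding covering_number_def by (rule LeastI_ex)
qed

lemma covering_number_le: "cover_mesh e A F \<Longrightarrow> covering_number e A \<le> card F"
  unfolding covering_number_def by (rule Least_le) auto

section \<open>Covering numbers as approximate contents\<close>

context
  fixes e :: real
  assumes e: "e > 0"
begin

lemma covering_number_mono:
  fixes A :: "'a::metric_space set"
  assumes K: "compact (UNIV :: 'a set)" and "A \<subseteq> B"
  shows "covering_number e A \<le> covering_number e B"
proof -
  obtain F where F: "cover_mesh e B F" "card F = covering_number e B"
    using covering_number_attained[OF K e] by blast
  then have "cover_mesh e A F" using assms(2) unfolding cover_mesh_def by auto
  then show ?thesis using covering_number_le F(2) by metis
qed

lemma covering_number_Un: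
  fixes A :: "'a::metric_space set"
  assumes K: "compact (UNIV :: 'a set)"
  shows "covering_number e (A \<union> B) \<le> covering_number e A + covering_number e B"
proof -
  obtain F where F: "cover_mesh e A F" "card F = covering_number e A"
    using covering_number_attained[OF K e] by blast
  obtain G where G: "cover_mesh e B G" "card G = covering_number e B"
    using covering_number_attained[OF K e] by blast
  have "cover_mesh e (A \<union> B) (F \<union> G)" using F G unfolding cover_mesh_def by auto
  from covering_number_le[OF this] show ?thesis using card_Un_le[of F G] F(2) G(2) by simp
qed

text \<open>Only the traces \<open>T \<inter> A\<close> can be transported, because \<open>f\<close>
  preserves distances on \<open>A\<close> alone.\<close>

lemma covering_number_isometric:
  fixes A :: "'a::metric_space set" and f :: "'a \<Rightarrow> 'a"
  assumes K: "compact (UNIV :: 'a set)" and f: "isometric_on A f"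
  shows "covering_number e (f ` A) \<le> covering_number e A"
proof -
  obtain F where F: "cover_mesh e A F" "card F = covering_number e A"
    using covering_number_attained[OF K e] by blast
  have "cover_mesh e (f ` A) ((\<lambda>T. f ` (T \<inter> A)) ` F)"
    unfolding cover_mesh_def
  proof (intro conjI)
    show "finite ((\<lambda>T. f ` (T \<inter> A)) ` F)" using F by (simp add: cover_mesh_def)
    show "f ` A \<subseteq> \<Union>((\<lambda>T. f ` (T \<inter> A)) ` F)" using F by (fastforce simp: cover_mesh_def)
    show "\<forall>T\<in>(\<lambda>T. f ` (T \<inter> A)) ` F. \<forall>u\<in>T. \<forall>v\<in>T. dist u v < e"
      using F isometric_onD[OF f] by (auto simp: cover_mesh_def)
  qed
  from covering_number_le[OF this] show ?thesis
    using card_image_le[of F "\<lambda>T. f ` (T \<inter> A)"] F by (simp add: cover_mesh_def)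
qed

text \<open>No covering set meets both \<open>A\<close> and \<open>B\<close>, so an optimal cover of
  the union contains disjoint subfamilies covering the two parts.\<close>

lemma covering_number_separated:
  fixes A :: "'a::metric_space set"
  assumes K: "compact (UNIV :: 'a set)" and sep: "\<And>a b. a \<in> A \<Longrightarrow> b \<in> B \<Longrightarrow> e \<le> dist a b"
  shows "covering_number e A + covering_number e B \<le> covering_number e (A \<union> B)"
proof -
  obtain F where F: "cover_mesh e (A \<union> B) F" "card F = covering_number e (A \<union> B)"
    using covering_number_attained[OF K e] by blast
  let ?FA = "{T \<in> F. T \<inter> A \<noteq> {}}" and ?FB = "{T \<in> F. T \<inter> B \<noteq> {}}"
  have fin: "finite F" using F by (simp add: cover_mesh_def)
  have dis: "?FA \<inter> ?FB = {}"
  proof (rule ccontr)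
    assume "?FA \<inter> ?FB \<noteq> {}"
    then obtain T a b where "T \<in> F" "a \<in> T" "a \<in> A" "b \<in> T" "b \<in> B" by blast
    then show False using sep[of a b] F(1) by (force simp: cover_mesh_def)
  qed
  have "A \<subseteq> \<Union>F" "B \<subseteq> \<Union>F" using F(1) by (simp_all add: cover_mesh_def)
  then have "A \<subseteq> \<Union>?FA" "B \<subseteq> \<Union>?FB" by blast+
  then have "cover_mesh e A ?FA" "cover_mesh e B ?FB" by (auto intro: cover_mesh_subset[OF F(1)])
  from this[THEN covering_number_le]
  have "covering_number e A + covering_number e B \<le> card ?FA + card ?FB" by simp
  also have "\<dots> = card (?FA \<union> ?FB)" using dis fin by (subst card_Un_disjoint) auto
  also have "\<dots> \<le> card F" using fin by (intro card_mono) auto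
  finally show ?thesis using F(2) by simp
qed

lemma covering_number_pos:
  fixes A :: "'a::metric_space set"
  assumes K: "compact (UNIV :: 'a set)" and "A \<noteq> {}"
  shows "covering_number e A > 0"
proof -
  obtain F where F: "cover_mesh e A F" "card F = covering_number e A"
    using covering_number_attained[OF K e] by blast
  then have "F \<noteq> {}" "finite F" using assms(2) by (auto simp: cover_mesh_def)
  then show ?thesis using F(2) card_gt_0_iff by metis
qed

end

text \<open>An isometry-invariant content on all subsets; additivity is only required of sets at
  positive distance, as for a metric outer measure. One inequality in \<open>isometric\<close>
  suffices because the inverse of an isometric map is isometric on the image.\<close>

locale isometric_content =
  fixes \<nu> :: "'a::metric_space set \<Rightarrow> real"
  assumes K: "compact (UNIV :: 'a set)"
    and nonneg: "0 \<le> \<nu> A" and UNIV_1: "\<nu> UNIV = 1"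
    and mono: "A \<subseteq> B \<Longrightarrow> \<nu> A \<le> \<nu> B"
    and subadd: "\<nu> (A \<union> B) \<le> \<nu> A + \<nu> B"
    and isometric: "isometric_on A f \<Longrightarrow> \<nu> (f ` A) \<le> \<nu> A"
    and separated: "0 < d \<Longrightarrow> (\<And>a b. a \<in> A \<Longrightarrow> b \<in> B \<Longrightarrow> d \<le> dist a b) \<Longrightarrow> \<nu> A + \<nu> B \<le> \<nu> (A \<union> B)"

text \<open>A cluster point of the normalised covering numbers.\<close>

lemma isometric_content_exists:
  assumes K: "compact (UNIV :: 'a::metric_space set)"
  shows "\<exists>\<nu> :: 'a set \<Rightarrow> real. isometric_content \<nu>"
proof -
  define N where "N k A = real (covering_number (1 / real (Suc k)) (A :: 'a set))" for k A
  define X where "X k A = N k A / N k UNIV" for k A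
  have e: "0 < 1 / real (Suc k)" for k by simp
  have N0: "0 < N k UNIV" for k
    unfolding N_def using covering_number_pos[OF e K, of UNIV k] by simp
  have N1: "N k A \<le> N k UNIV" for k A
    unfolding N_def using covering_number_mono[OF e K, of A UNIV k] by simp
  have X01: "X k A \<in> {0..1}" for k A
    using N0[of k] N1[of k A] by (simp add: X_def) (simp add: N_def)
  \<comment> \<open>One filter serves all subsets of the space at once, so the inequalities between
    their covering numbers survive in the limit.\<close>
  obtain \<nu> G where G: "G \<noteq> bot" "G \<le> sequentially" and lim: "\<And>A. ((\<lambda>k. X k A) \<longlongrightarrow> \<nu> A) G"
    using pointwise_cluster_filter[of "{0..1::real}" X, OF compact_Icc X01] by blast
  have "isometric_content \<nu>"
  proof
    show "compact (UNIV :: 'a set)" by fact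
    show "0 \<le> \<nu> A" for A
      using X01 by (intro tendsto_lowerbound[OF lim _ G(1)]) auto
    show "\<nu> UNIV = 1"
    proof (rule tendsto_unique[OF G(1) lim])
      have "X k UNIV = 1" for k using N0[of k] by (simp add: X_def)
      then show "((\<lambda>k. X k UNIV) \<longlongrightarrow> 1) G" by simp
    qed
    show "\<nu> A \<le> \<nu> B" if "A \<subseteq> B" for A B
    proof (rule tendsto_le[OF G(1) lim lim])
      have "X k A \<le> X k B" for k
        unfolding X_def N_def using covering_number_mono[OF e K that, of k] by (intro divide_right_mono) auto
      then show "\<forall>\<^sub>F k in G. X k A \<le> X k B" by simp
    qed
    show "\<nu> (A \<union> B) \<le> \<nu> A + \<nu> B" for A B
    proof (rule tendsto_le[OF G(1) tendsto_add[OF lim lim] lim])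
      have "X k (A \<union> B) \<le> X k A + X k B" for k
        unfolding X_def N_def add_divide_distrib[symmetric]
        using covering_number_Un[OF e K, of k A B] by (intro divide_right_mono) auto
      then show "\<forall>\<^sub>F k in G. X k (A \<union> B) \<le> X k A + X k B" by simp
    qed
    show "\<nu> (f ` A) \<le> \<nu> A" if "isometric_on A f" for A and f :: "'a \<Rightarrow> 'a"
    proof (rule tendsto_le[OF G(1) lim lim])
      have "X k (f ` A) \<le> X k A" for k
        unfolding X_def N_def using covering_number_isometric[OF e K that, of k] by (intro divide_right_mono) auto
      then show "\<forall>\<^sub>F k in G. X k (f ` A) \<le> X k A" by simp
    qed
    show "\<nu> A + \<nu> B \<le> \<nu> (A \<union> B)"
      if d: "0 < d" "\<And>a b. a \<in> A \<Longrightarrow> b \<in> B \<Longrightarrow> d \<le> dist a b" for A B d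
    proof (rule tendsto_le[OF G(1) lim tendsto_add[OF lim lim]])
      obtain n where n: "1 / real (Suc n) < d" by (rule nat_approx_posE[OF d(1)])
      \<comment> \<open>Once the mesh is below \<open>d\<close>, no covering set can meet both
        \<open>A\<close> and \<open>B\<close>.\<close>
      have "X k A + X k B \<le> X k (A \<union> B)" if "n \<le> k" for k
      proof -
        have "1 / real (Suc k) \<le> 1 / real (Suc n)" using that by (simp add: frac_le)
        then have "covering_number (1 / real (Suc k)) A + covering_number (1 / real (Suc k)) B
            \<le> covering_number (1 / real (Suc k)) (A \<union> B)"
          using n d(2) by (intro covering_number_separated[OF e K]) force
        then show ?thesis
          unfolding X_def N_def add_divide_distrib[symmetric] by (intro divide_right_mono) auto
      qed
      then have "\<forall>\<^sub>F k in sequentially. X k A + X k B \<le> X k (A \<union> B)"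
        unfolding eventually_sequentially by blast
      then show "\<forall>\<^sub>F k in G. X k A + X k B \<le> X k (A \<union> B)" using G(2) by (rule filter_leD[rotated])
    qed
  qed
  then show ?thesis by (rule exI[of _ \<nu>])
qed

lemma disjoint_compact_separated:
  fixes C D :: "'a::metric_space set"
  assumes "compact C" "compact D" "C \<inter> D = {}"
  obtains d where "d > 0" "\<And>x y. x \<in> C \<Longrightarrow> y \<in> D \<Longrightarrow> d \<le> dist x y"
proof -
  have "open (- D)" using assms(2) by (simp add: compact_imp_closed open_Compl)
  then obtain d where d: "0 < d" "\<And>x. x \<in> C \<Longrightarrow> ball x d \<subseteq> - D"
    using Heine_Borel_lemma[OF assms(1), of "{- D}"] assms(3) by (auto simp: disjoint_eq_subset_Compl)
  have "d \<le> dist x y" if "x \<in> C" "y \<in> D" for x y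
    using d(2)[OF that(1)] that(2) by (auto simp: subset_iff not_less[symmetric])
  then show thesis by (rule that[OF d(1)])
qed

text \<open>The sets \<open>C - V\<close> and \<open>C - U\<close> are disjoint and compact, hence
  at some distance \<open>d\<close>. Deleting the open \<open>d/2\<close>-neighbourhood of
  \<open>C - U\<close> leaves a compact subset of \<open>U\<close>, and symmetrically for
  \<open>V\<close>; the two neighbourhoods are disjoint, so no point of \<open>C\<close> is
  lost.\<close>

lemma compact_split:
  fixes C :: "'a::metric_space set"
  assumes C: "compact C" and sub: "C \<subseteq> U \<union> V" and U: "open U" and V: "open V"
  obtains C1 C2 where "compact C1" "compact C2" "C1 \<subseteq> U" "C2 \<subseteq> V" "C = C1 \<union> C2"
proof -
  have "compact (C - V)" "compact (C - U)" "(C - V) \<inter> (C - U) = {}"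
    using C U V sub by (auto intro: compact_diff)
  then obtain d where d: "d > 0" "\<And>x y. x \<in> C - V \<Longrightarrow> y \<in> C - U \<Longrightarrow> d \<le> dist x y"
    by (rule disjoint_compact_separated) blast
  define W1 where "W1 = (\<Union>x\<in>C - V. ball x (d/2))"
  define W2 where "W2 = (\<Union>x\<in>C - U. ball x (d/2))"
  have "open W1" "open W2" by (auto simp: W1_def W2_def)
  have disj: "z \<notin> W2" if z1: "z \<in> W1" for z
  proof
    assume "z \<in> W2"
    then obtain x y where xy: "x \<in> C - V" "y \<in> C - U" "dist x z < d/2" "dist y z < d/2"
      using z1 by (auto simp: W1_def W2_def)
    then have "dist x y < d" using dist_triangle2[of x y z] by simp
    then show False using d(2) xy by force
  qed
  show thesis
  proof (rule that[of "C - W2" "C - W1"])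
    show "compact (C - W2)" "compact (C - W1)" using C \<open>open W1\<close> \<open>open W2\<close> by (auto intro: compact_diff)
    have "x \<in> W1" if "x \<in> C - V" for x using that d(1) by (auto simp: W1_def intro!: bexI[of _ x])
    then show "C - W1 \<subseteq> V" by blast
    have "x \<in> W2" if "x \<in> C - U" for x using that d(1) by (auto simp: W2_def intro!: bexI[of _ x])
    then show "C - W2 \<subseteq> U" by blast
    show "C = C - W2 \<union> (C - W1)" using disj by blast
  qed
qed

section \<open>Regularisation of a content and Caratheodory's construction\<close>

context isometric_content
begin

definition inner :: "'a set \<Rightarrow> ennreal" where
  "inner U = (SUP C\<in>{C. compact C \<and> C \<subseteq> U}. ennreal (\<nu> C))"

definition outer :: "'a set \<Rightarrow> ennreal" where
  "outer A = (INF U\<in>{U. open U \<and> A \<subseteq> U}. inner U)"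

text \<open>The empty set is vacuously separated from itself, so twice its content is at most its
  content.\<close>

lemma content_empty: "\<nu> {} = 0"
  using separated[of 1 "{}" "{}"] nonneg[of "{}"] by simp

lemma inner_ge: "compact C \<Longrightarrow> C \<subseteq> U \<Longrightarrow> ennreal (\<nu> C) \<le> inner U"
  unfolding inner_def by (rule SUP_upper) simp

lemma inner_mono: "U \<subseteq> V \<Longrightarrow> inner U \<le> inner V"
  unfolding inner_def by (rule SUP_subset_mono) auto

lemma inner_UNIV: "inner UNIV = 1"
proof (rule antisym)
  show "inner UNIV \<le> 1" unfolding inner_def
    using mono[OF subset_UNIV] UNIV_1 by (intro SUP_least) simp
  show "1 \<le> inner UNIV" using inner_ge[OF K] UNIV_1 by simp
qed

lemma outer_open: "open U \<Longrightarrow> outer U = inner U"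
  unfolding outer_def
  by (intro antisym INF_lower2[of U] INF_greatest) (auto intro: inner_mono)

lemma outer_le: "open U \<Longrightarrow> A \<subseteq> U \<Longrightarrow> outer A \<le> inner U"
  unfolding outer_def by (rule INF_lower) simp

lemma outer_mono: "A \<subseteq> B \<Longrightarrow> outer A \<le> outer B"
  unfolding outer_def by (rule INF_superset_mono) auto

lemma outer_le_1: "outer A \<le> 1"
  using outer_le[OF open_UNIV subset_UNIV] inner_UNIV by simp

lemma content_le_sum_inner:
  assumes "finite I" "\<And>i. i \<in> I \<Longrightarrow> open (U i)" "compact C" "C \<subseteq> (\<Union>i\<in>I. U i)"
  shows "ennreal (\<nu> C) \<le> (\<Sum>i\<in>I. inner (U i))"
  using assms
proof (induction I arbitrary: C)
  case empty
  then show ?case by (simp add: content_empty)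
next
  case (insert i I)
  have "C \<subseteq> U i \<union> (\<Union>i\<in>I. U i)" "open (U i)" "open (\<Union>i\<in>I. U i)" using insert by auto
  from compact_split[OF insert.prems(2) this]
  obtain C1 C2 where C: "compact C1" "compact C2" "C1 \<subseteq> U i" "C2 \<subseteq> (\<Union>i\<in>I. U i)" "C = C1 \<union> C2" .
  have "ennreal (\<nu> C) \<le> ennreal (\<nu> C1 + \<nu> C2)" unfolding C(5) by (rule ennreal_leI[OF subadd])
  also have "\<dots> = ennreal (\<nu> C1) + ennreal (\<nu> C2)" by (simp add: nonneg)
  also have "\<dots> \<le> inner (U i) + (\<Sum>i\<in>I. inner (U i))"
    using insert.IH[OF _ C(2,4)] insert.prems(1) inner_ge[OF C(1,3)] by (intro add_mono) auto
  finally show ?case using insert.hyps by simp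
qed

text \<open>Compactness reduces the countable cover to a finite one, which
  \<open>compact_split\<close> handles piece by piece.\<close>

lemma inner_countably_subadditive:
  assumes "\<And>i::nat. open (U i)"
  shows "inner (\<Union>i. U i) \<le> (\<Sum>i. inner (U i))"
  unfolding inner_def[of "\<Union>i. U i"]
proof (rule SUP_least)
  fix C assume "C \<in> {C. compact C \<and> C \<subseteq> (\<Union>i. U i)}"
  then have C: "compact C" "C \<subseteq> (\<Union>i. U i)" by auto
  then obtain I where I: "finite I" "C \<subseteq> (\<Union>i\<in>I. U i)"
    using compactE_image[of C UNIV U] assms by metis
  have "ennreal (\<nu> C) \<le> (\<Sum>i\<in>I. inner (U i))"
    using assms by (intro content_le_sum_inner I C)
  also have "\<dots> \<le> (\<Sum>i. inner (U i))" by (rule sum_le_suminf) (auto simp: I)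
  finally show "ennreal (\<nu> C) \<le> (\<Sum>i. inner (U i))" .
qed

lemma outer_countably_subadditive:
  fixes A :: "nat \<Rightarrow> 'a set"
  shows "outer (\<Union>i. A i) \<le> (\<Sum>i. outer (A i))"
proof (rule ennreal_le_epsilon)
  fix e :: real assume e: "0 < e"
  have "\<exists>U. open U \<and> A i \<subseteq> U \<and> inner U \<le> outer (A i) + ennreal (e * (1/2) ^ Suc i)" for i
  proof -
    have "0 < e * (1/2) ^ Suc i" using e by simp
    moreover have "outer (A i) \<noteq> \<infinity>" using outer_le_1[of "A i"] by (auto simp: top_unique)
    ultimately have "\<exists>U\<in>{U. open U \<and> A i \<subseteq> U}. inner U < outer (A i) + ennreal (e * (1/2) ^ Suc i)"
      by (intro INF_approx_ennreal[OF _ outer_def]) simp_all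
    then show ?thesis using less_imp_le by blast
  qed
  then obtain U where U: "\<And>i. open (U i)" "\<And>i. A i \<subseteq> U i"
     "\<And>i. inner (U i) \<le> outer (A i) + ennreal (e * (1/2) ^ Suc i)" by metis
  have s: "(\<Sum>i. ennreal (e * (1/2) ^ Suc i)) = ennreal e"
    using e sums_mult[OF power_half_series, of e] by (intro suminf_ennreal_eq) auto
  have "outer (\<Union>i. A i) \<le> inner (\<Union>i. U i)" using U by (intro outer_le) auto
  also have "\<dots> \<le> (\<Sum>i. inner (U i))" by (rule inner_countably_subadditive[OF U(1)])
  also have "\<dots> \<le> (\<Sum>i. outer (A i) + ennreal (e * (1/2) ^ Suc i))"
    using U(3) by (intro suminf_le summableI) auto
  also have "\<dots> = (\<Sum>i. outer (A i)) + ennreal e"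
    using suminf_add[OF summableI summableI, of "\<lambda>i. outer (A i)" "\<lambda>i. ennreal (e * (1/2) ^ Suc i)"]
    by (simp only: s)
  finally show "outer (\<Union>i. A i) \<le> (\<Sum>i. outer (A i)) + ennreal e" .
qed

text \<open>Caratheodory's criterion for open \<open>G\<close>. A compact \<open>C\<close> inside
  \<open>W \<inter> G\<close> and a compact \<open>D\<close> inside \<open>W - C\<close> have
  positive distance, so their contents add up to at most \<open>inner W\<close>; suprema over
  \<open>D\<close> and then over \<open>C\<close> give the claim.\<close>

lemma outer_open_split:
  assumes G: "open G"
  shows "outer (G \<inter> A) + outer (A - G) \<le> outer A"
  unfolding outer_def[of A]
proof (rule INF_greatest)
  fix W assume "W \<in> {U. open U \<and> A \<subseteq> U}"
  then have W: "open W" "A \<subseteq> W" by auto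
  have *: "ennreal (\<nu> C) + outer (W - G) \<le> inner W" if C: "compact C" "C \<subseteq> W \<inter> G" for C
  proof -
    have "outer (W - G) \<le> inner (W - C)"
      using C W by (intro outer_le open_Diff compact_imp_closed) auto
    then have "ennreal (\<nu> C) + outer (W - G) \<le> ennreal (\<nu> C) + inner (W - C)"
      by (rule add_left_mono)
    also have "\<dots> = (SUP D\<in>{D. compact D \<and> D \<subseteq> W - C}. ennreal (\<nu> C) + ennreal (\<nu> D))"
      unfolding inner_def by (rule ennreal_SUP_add_right) auto
    also have "\<dots> \<le> inner W"
    proof (rule SUP_least)
      fix D assume "D \<in> {D. compact D \<and> D \<subseteq> W - C}"
      then have D: "compact D" "D \<subseteq> W - C" by auto
      then have "C \<inter> D = {}" by blast
      then obtain d where d: "d > 0" "\<And>x y. x \<in> C \<Longrightarrow> y \<in> D \<Longrightarrow> d \<le> dist x y"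
        by (rule disjoint_compact_separated[OF C(1) D(1)]) blast
      have "ennreal (\<nu> C) + ennreal (\<nu> D) = ennreal (\<nu> C + \<nu> D)" by (simp add: nonneg)
      also have "\<dots> \<le> ennreal (\<nu> (C \<union> D))" using separated[OF d] by (intro ennreal_leI) simp
      also have "\<dots> \<le> inner W" using C D by (intro inner_ge compact_Un) auto
      finally show "ennreal (\<nu> C) + ennreal (\<nu> D) \<le> inner W" .
    qed
    finally show ?thesis .
  qed
  have "outer (G \<inter> A) + outer (A - G) \<le> inner (W \<inter> G) + outer (W - G)"
  proof (rule add_mono)
    show "outer (G \<inter> A) \<le> inner (W \<inter> G)" using W G by (intro outer_le open_Int) auto
    show "outer (A - G) \<le> outer (W - G)" using W(2) by (intro outer_mono) auto
  qed
  also have "\<dots> = (SUP C\<in>{C. compact C \<and> C \<subseteq> W \<inter> G}. ennreal (\<nu> C) + outer (W - G))"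
    unfolding inner_def by (rule ennreal_SUP_add_left[symmetric]) auto
  also have "\<dots> \<le> inner W"
    by (rule SUP_least, rule *) simp_all
  finally show "outer (G \<inter> A) + outer (A - G) \<le> inner W" .
qed

lemma outer_measure_space_outer: "outer_measure_space UNIV outer"
proof -
  have "outer {} = 0"
  proof -
    have "inner {} = 0" unfolding inner_def by (simp add: content_empty)
    then show ?thesis by (simp add: outer_open)
  qed
  then show ?thesis
    unfolding outer_measure_space_def positive_def increasing_def countably_subadditive_def
    by (simp add: outer_mono outer_countably_subadditive)
qed

lemma borel_subset_lambda_system: "sets borel \<subseteq> lambda_system UNIV UNIV outer"
proof -
  have ms: "measure_space UNIV (lambda_system UNIV UNIV outer) outer"
    using sigma_algebra.caratheodory_lemma[OF _ outer_measure_space_outer, of UNIV]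
      sigma_algebra_Pow[of "UNIV :: 'a set"] by simp
  then have "sigma_algebra UNIV (lambda_system UNIV UNIV outer)" by (simp add: measure_space_def)
  moreover have "{S. open S} \<subseteq> lambda_system UNIV UNIV outer"
  proof safe
    fix G :: "'a set" assume G: "open G"
    have "outer A \<le> outer (G \<inter> A) + outer (A - G)" for A
    proof -
      have "subadditive UNIV outer"
        using outer_measure_space_outer ring_of_sets.countably_subadditive_subadditive[of UNIV UNIV outer]
          algebra.axioms(1)[OF algebra_Pow[of "UNIV :: 'a set"]]
        by (simp add: outer_measure_space_def)
      moreover have "(G \<inter> A) \<inter> (A - G) = {}" by blast
      ultimately have "outer ((G \<inter> A) \<union> (A - G)) \<le> outer (G \<inter> A) + outer (A - G)"
        unfolding subadditive_def by simp
      moreover have "(G \<inter> A) \<union> (A - G) = A" by blast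
      ultimately show ?thesis by simp
    qed
    with outer_open_split[OF G] have "outer (G \<inter> A) + outer (A - G) = outer A" for A
      by (simp add: antisym)
    moreover have "(UNIV - G) \<inter> A = A - G" for A by blast
    ultimately show "G \<in> lambda_system UNIV UNIV outer" by (simp add: lambda_system_def)
  qed
  ultimately have "sigma_sets UNIV {S. open S} \<subseteq> lambda_system UNIV UNIV outer"
    by (rule sigma_algebra.sigma_sets_subset)
  then show ?thesis by (simp add: borel_def)
qed

definition content_measure :: "'a measure" where
  "content_measure = measure_of UNIV (sets borel) outer"

lemma sets_content_measure: "sets content_measure = sets borel"
  using sets.sigma_sets_eq[of "borel :: 'a measure"] sets.space_closed[of "borel :: 'a measure"]
  by (simp add: content_measure_def)

lemma emeasure_content_measure:
  assumes "A \<in> sets borel"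
  shows "emeasure content_measure A = outer A"
  unfolding content_measure_def
proof (rule emeasure_measure_of_sigma[OF _ _ _ assms])
  have ms: "measure_space UNIV (lambda_system UNIV UNIV outer) outer"
    using sigma_algebra.caratheodory_lemma[OF _ outer_measure_space_outer, of UNIV]
      sigma_algebra_Pow[of "UNIV :: 'a set"] by simp
  show "sigma_algebra UNIV (sets (borel :: 'a measure))"
    using sets.sigma_algebra_axioms[of "borel :: 'a measure"] by simp
  show "positive (sets borel) outer"
    using ms by (simp add: measure_space_def positive_def)
  show "countably_additive (sets borel) outer"
    using ms borel_subset_lambda_system unfolding measure_space_def countably_additive_def
    by (meson order_trans subsetD)
qed

text \<open>Compact subsets of \<open>U\<close> are carried to compact subsets of \<open>V\<close>,
  and applying \<open>isometric\<close> to the inverse map shows that they lose no content. Only the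
  open sets \<open>U\<close> and \<open>V\<close> are compared, since the image of \<open>U\<close>
  need not be open.\<close>

lemma content_measure_embedding:
  assumes U: "open U" and V: "open V" and f: "isometric_on U f" "f ` U \<subseteq> V"
  shows "emeasure content_measure U \<le> emeasure content_measure V"
proof -
  have "inner U \<le> inner V"
    unfolding inner_def[of U]
  proof (rule SUP_least)
    fix C assume "C \<in> {C. compact C \<and> C \<subseteq> U}"
    then have C: "compact C" "C \<subseteq> U" by auto
    have fC: "isometric_on C f" using isometric_on_subset[OF f(1) C(2)] .
    have "inv_into C f ` f ` C = C" using isometric_on_inj[OF fC] by (simp add: inv_into_image_cancel)
    then have "\<nu> C \<le> \<nu> (f ` C)" using isometric[OF isometric_on_inv[OF fC]] by simp
    then have "ennreal (\<nu> C) \<le> ennreal (\<nu> (f ` C))" by (rule ennreal_leI)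
    also have "\<dots> \<le> inner V" using C f by (intro inner_ge compact_isometric_image[OF fC]) auto
    finally show "ennreal (\<nu> C) \<le> inner V" .
  qed
  then show ?thesis using U V by (simp add: emeasure_content_measure outer_open)
qed

end

text \<open>Phrased as monotonicity under embeddings, a property that every strongly isometrically
  compatible probability shares, so that one locale later serves both existence and
  uniqueness.\<close>

theorem isometric_embedding_monotone_measure_exists:
  assumes "compact (UNIV :: 'a::metric_space set)"
  obtains M :: "'a::metric_space measure" where "sets M = sets borel" "prob_space M"
    "\<And>U V f. open U \<Longrightarrow> open V \<Longrightarrow> isometric_on U f \<Longrightarrow> f ` U \<subseteq> V \<Longrightarrow> emeasure M U \<le> emeasure M V"
proof -
  obtain \<nu> :: "'a set \<Rightarrow> real" where "isometric_content \<nu>"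
    using isometric_content_exists[OF assms] ..
  then interpret isometric_content \<nu> .
  have "space content_measure = UNIV" using sets_eq_imp_space_eq[OF sets_content_measure] by simp
  moreover have "emeasure content_measure UNIV = 1"
    by (simp add: emeasure_content_measure outer_open inner_UNIV)
  ultimately have "prob_space content_measure" using prob_spaceI[of content_measure] by metis
  with sets_content_measure show thesis by (rule that[OF _ _ content_measure_embedding])
qed

section \<open>Measures on a homogeneous ball\<close>

text \<open>No second countability class is available for \<open>'a\<close>, so measurability of the
  distance with respect to the product \<open>\<sigma>\<close>-algebra is derived from total boundedness.\<close>

lemma compact_UNIV_countable_dense:
  assumes K: "compact (UNIV :: 'a::metric_space set)"
  obtains D :: "'a::metric_space set" where "countable D" "\<And>x e. 0 < e \<Longrightarrow> \<exists>d\<in>D. dist d x < e"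
proof -
  have "\<exists>k. finite k \<and> (UNIV :: 'a set) \<subseteq> (\<Union>x\<in>k. ball x (1 / real (Suc n)))" for n
  proof -
    have "0 < 1 / real (Suc n)" by simp
    with seq_compact_imp_totally_bounded[OF compact_imp_seq_compact[OF K]] show ?thesis by blast
  qed
  then obtain k where k: "\<And>n. finite (k n)" "\<And>n. (UNIV :: 'a set) \<subseteq> (\<Union>x\<in>k n. ball x (1 / real (Suc n)))"
    by metis
  show thesis
  proof (rule that[of "\<Union>n. k n"])
    show "countable (\<Union>n. k n)" using k(1) by (simp add: countable_finite)
    fix x :: 'a and e :: real assume "0 < e"
    then obtain n where n: "1 / real (Suc n) < e" by (rule nat_approx_posE)
    have "x \<in> (\<Union>x\<in>k n. ball x (1 / real (Suc n)))" using k(2)[of n] by blast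
    then obtain d where d: "d \<in> k n" "dist d x < 1 / real (Suc n)" by (elim UN_E) simp
    have "d \<in> (\<Union>n. k n)" "dist d x < e" using d n by auto
    then show "\<exists>d\<in>\<Union>n. k n. dist d x < e" by (rule bexI[rotated])
  qed
qed

lemma dist_less_sets:
  fixes X Y :: "'b \<Rightarrow> 'a::metric_space"
  assumes K: "compact (UNIV :: 'a set)"
    and X: "X \<in> borel_measurable N" and Y: "Y \<in> borel_measurable N"
  shows "{w \<in> space N. dist (X w) (Y w) < r} \<in> sets N"
proof -
  obtain D :: "'a set" where D: "countable D" "\<And>x e. 0 < e \<Longrightarrow> \<exists>d\<in>D. dist d x < e"
    using compact_UNIV_countable_dense[OF K] by blast
  \<comment> \<open>The distance is below \<open>r\<close> exactly if some point of \<open>D\<close>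
    and some rational \<open>q\<close> split \<open>r\<close> into bounds for the two distances from
    that point; only countably many preimages of balls are involved.\<close>
  have "{w \<in> space N. dist (X w) (Y w) < r} =
     (\<Union>d\<in>D. \<Union>q\<in>\<rat>. (X -` ball d q \<inter> space N) \<inter> (Y -` ball d (r - q) \<inter> space N))" (is "?L = ?R")
  proof
    show "?L \<subseteq> ?R"
    proof
      fix w assume w: "w \<in> ?L"
      \<comment> \<open>A third of the gap: if \<open>d\<close> is within \<open>e\<close> of
        \<open>X w\<close> and \<open>q\<close> lies between \<open>e\<close> and
        \<open>2 * e\<close>, then the distance from \<open>d\<close> to \<open>Y w\<close> is below
        \<open>r - 2 * e\<close>, hence below \<open>r - q\<close>.\<close>
      define e where "e = (r - dist (X w) (Y w)) / 3"
      have e: "0 < e" using w by (simp add: e_def)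
      obtain d where d: "d \<in> D" "dist d (X w) < e" using D(2)[OF e] by blast
      obtain q where q: "q \<in> \<rat>" "e < q" "q < 2 * e" using Rats_dense_in_real[of e "2*e"] e by auto
      have "e * 3 = r - dist (X w) (Y w)" unfolding e_def by simp
      then have "dist d (Y w) < r - q" using dist_triangle[of d "Y w" "X w"] d(2) q(3) by linarith
      moreover have "dist d (X w) < q" using d q by simp
      ultimately show "w \<in> ?R" using d(1) q(1) w by auto
    qed
    show "?R \<subseteq> ?L"
    proof
      fix w assume "w \<in> ?R"
      then obtain d q where "dist d (X w) < q" "dist d (Y w) < r - q" "w \<in> space N" by auto
      then show "w \<in> ?L" using dist_triangle3[of "X w" "Y w" d] by simp
    qed
  qed
  also have "\<dots> \<in> sets N"
    using D(1) countable_rat X Y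
    by (intro sets.countable_UN' sets.Int measurable_sets[OF X] measurable_sets[OF Y]) auto
  finally show ?thesis .
qed

lemma sets_borel_eq: "sets borel = sigma_sets UNIV (Collect open)"
  unfolding borel_def by (rule sets_measure_of) simp

section \<open>A ball that is homogeneous at one scale and receives charts from everywhere\<close>

locale homogeneous_ball =
  fixes y0 :: "'a::metric_space" and s :: real
  assumes K: "compact (UNIV :: 'a set)" and s: "0 < s"
    and homogeneous: "z \<in> ball y0 s \<Longrightarrow> \<exists>f. isometry_between (ball z s) (ball y0 s) f \<and> f z = y0"
    and top: "hom_le x y0"

text \<open>The bound \<open>r\<close> allows charts to be chosen with image in any prescribed ball
  around \<open>y0\<close>.\<close>

lemma (in homogeneous_ball) chart:
  fixes x :: 'a
  assumes "0 < r"
  obtains e h where "0 < e" "e \<le> r" "isometric_on (ball x e) h" "h ` ball x e \<subseteq> ball y0 e" "h x = y0"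
proof -
  obtain t where t: "0 < t" "pointed_embedding t x y0" using top[of x] by (auto simp: hom_le_iff)
  then have "pointed_embedding (min t r) x y0" by (auto intro: pointed_embedding_mono)
  then obtain h where h: "isometric_on (ball x (min t r)) h" "h x = y0" by (rule pointed_embeddingE)
  have "h ` ball x (min t r) \<subseteq> ball y0 (min t r)"
    using isometric_on_ball_image[OF h(1) order_refl] h(2) by simp
  then show thesis using that[of "min t r" h] t(1) assms h by simp
qed

lemma isometry_between_ball_image:
  assumes f: "isometry_between (ball z s) (ball y s) f" and u: "ball u r \<subseteq> ball z s" "ball (f u) r \<subseteq> ball y s" "u \<in> ball z s"
  shows "f ` ball u r = ball (f u) r"
proof
  have fi: "isometric_on (ball z s) f" "f ` ball z s = ball y s" using f by (auto simp: isometry_between_iff)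
  show "f ` ball u r \<subseteq> ball (f u) r"
    by (rule isometric_on_ball_image[OF isometric_on_subset[OF fi(1) u(1)] order_refl])
  show "ball (f u) r \<subseteq> f ` ball u r"
  proof
    fix v assume v: "v \<in> ball (f u) r"
    then have "v \<in> f ` ball z s" using u(2) fi(2) by blast
    then obtain w where w: "w \<in> ball z s" "v = f w" by (rule imageE) auto
    have "dist u w = dist (f u) (f w)" using isometric_onD[OF fi(1) u(3) w(1)] by simp
    then show "v \<in> f ` ball u r" using v w(2) by (auto intro!: image_eqI[of _ _ w])
  qed
qed

lemma isometric_open_vimage:
  assumes "isometric_on (ball z s) f" "open X"
  shows "open (ball z s \<inter> f -` X)"
  using continuous_open_preimage[OF isometric_on_continuous[OF assms(1)] open_ball assms(2)] .

text \<open>The monotonicity holds for the measure built from the content and for every compatible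
  probability. It compares open sets only and says nothing directly about the measure of a non-open
  image.\<close>

locale homogeneous_ball_measure = homogeneous_ball y0 s + prob_space M
  for y0 :: "'a::metric_space" and s and M :: "'a measure" +
  assumes sets_M: "sets M = sets borel"
    and embedding_mono:
      "open U \<Longrightarrow> open V \<Longrightarrow> isometric_on U f \<Longrightarrow> f ` U \<subseteq> V \<Longrightarrow> emeasure M U \<le> emeasure M V"
begin

lemma space_M: "space M = UNIV"
  using sets_eq_imp_space_eq[OF sets_M] by simp

text \<open>Monotonicity is applied to \<open>f\<close> and to its inverse; both times the image has
  to be open.\<close>

lemma open_isometry_invariant:
  assumes U: "open U" and f: "isometric_on U f" and V: "open (f ` U)"
  shows "emeasure M (f ` U) = emeasure M U"
proof (rule antisym)
  show "emeasure M U \<le> emeasure M (f ` U)" by (rule embedding_mono[OF U V f order_refl])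
  have "inv_into U f ` f ` U = U" using isometric_on_inj[OF f] by (simp add: inv_into_image_cancel)
  then show "emeasure M (f ` U) \<le> emeasure M U"
    using embedding_mono[OF V U isometric_on_inv[OF f]] by simp
qed

text \<open>If the ball were null, every point would have a null neighbourhood through a chart, and
  by compactness the whole space would be null.\<close>

lemma ball_y0_pos:
  assumes r: "0 < r"
  shows "0 < emeasure M (ball y0 r)"
proof (rule ccontr)
  assume "\<not> 0 < emeasure M (ball y0 r)"
  then have 0: "emeasure M (ball y0 r) = 0" by (simp add: zero_less_iff_neq_zero)
  have "\<exists>e>0. emeasure M (ball x e) = 0" for x
  proof -
    obtain e h where e: "0 < e" "e \<le> r" "isometric_on (ball x e) h" "h ` ball x e \<subseteq> ball y0 e"
      by (rule chart[OF r])
    have "h ` ball x e \<subseteq> ball y0 r" using e(2,4) subset_ball[OF e(2)] by blast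
    from embedding_mono[OF open_ball open_ball e(3) this] 0 e(1) show ?thesis by auto
  qed
  then obtain e where e: "\<And>x. 0 < e x" "\<And>x. emeasure M (ball x (e x)) = 0" by metis
  have "(UNIV :: 'a set) \<subseteq> (\<Union>x\<in>UNIV. ball x (e x))" using e(1) by auto
  then obtain C where C: "finite C" "(UNIV :: 'a set) \<subseteq> (\<Union>x\<in>C. ball x (e x))"
    using compactE_image[OF K, of UNIV "\<lambda>x. ball x (e x)"] by auto
  have "emeasure M (\<Union>x\<in>C. ball x (e x)) \<le> (\<Sum>x\<in>C. emeasure M (ball x (e x)))"
    using C(1) by (intro emeasure_subadditive_finite) (auto simp: sets_M)
  then have "emeasure M (space M) = 0" using C(2) e(2) by (simp add: space_M top.extremum_unique)
  then show False using emeasure_space_1 by simp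
qed

lemma ball_measure_eq:
  assumes z: "z \<in> ball y0 s" and t: "t \<le> s"
  shows "emeasure M (ball z t) = emeasure M (ball y0 t)"
proof -
  obtain f where f: "isometry_between (ball z s) (ball y0 s) f" "f z = y0" using homogeneous[OF z] by blast
  have sub: "ball z t \<subseteq> ball z s" by (rule subset_ball[OF t])
  have im: "f ` ball z t = ball y0 t"
    using isometry_between_ball_image[OF f(1) sub] f(2) subset_ball[OF t, of y0] s by simp
  have fi: "isometric_on (ball z t) f"
    using f(1) isometric_on_subset[OF _ sub] by (auto simp: isometry_between_iff)
  have "emeasure M (f ` ball z t) = emeasure M (ball z t)"
    by (rule open_isometry_invariant[OF open_ball fi]) (simp add: im)
  then show ?thesis by (simp add: im)
qed

lemma ball_pos:
  assumes z: "z \<in> ball y0 s" and r: "0 < r"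
  shows "0 < emeasure M (ball z r)"
proof -
  define t where "t = min r s"
  have t: "0 < t" "t \<le> r" "t \<le> s" using r s by (auto simp: t_def)
  have "0 < emeasure M (ball z t)" using ball_y0_pos[OF t(1)] ball_measure_eq[OF z t(3)] by simp
  also have "\<dots> \<le> emeasure M (ball z r)" using subset_ball[OF t(2)] by (intro emeasure_mono) (auto simp: sets_M)
  finally show ?thesis .
qed

text \<open>The isometry is extended by the constant \<open>y0\<close> to a Borel map of the whole
  space. The two restricted measures then agree on open sets, a generator stable under intersection,
  and hence on Borel sets.\<close>

lemma restricted_distr_isometry:
  assumes f: "isometry_between (ball z s) (ball y0 s) f" and z: "f z = y0"
    and X: "X \<in> sets borel"
  defines "f' \<equiv> \<lambda>u. if u \<in> ball z s then f u else y0"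
  shows "emeasure M (ball z s \<inter> f' -` X) = emeasure M (ball y0 s \<inter> X)"
    and "f' \<in> borel_measurable borel"
proof -
  have fi: "isometric_on (ball z s) f" "f ` ball z s = ball y0 s" using f by (auto simp: isometry_between_iff)
  show f'_meas: "f' \<in> borel_measurable borel"
    unfolding f'_def using isometric_on_continuous[OF fi(1)]
    by (intro borel_measurable_continuous_on_if) auto
  then have f'M: "f' \<in> measurable (density M (indicator (ball z s))) borel"
    by (simp add: measurable_cong_sets[OF sets_M refl] )
  have bM: "ball z s \<in> sets M" "ball y0 s \<in> sets M" by (auto simp: sets_M)
  have eq1: "emeasure (distr (density M (indicator (ball z s))) borel f') Y = emeasure M (ball z s \<inter> f' -` Y)"
    if "Y \<in> sets borel" for Y
  proof -
    have "f' -` Y \<in> sets M" using measurable_sets[OF f'_meas that] by (simp add: sets_M)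
    then show ?thesis
      using that f'M by (simp add: emeasure_distr space_M emeasure_restricted[OF bM(1)])
  qed
  have eq2: "emeasure (density M (indicator (ball y0 s))) Y = emeasure M (ball y0 s \<inter> Y)"
    if "Y \<in> sets borel" for Y
    using that by (simp add: sets_M emeasure_restricted[OF bM(2)])
  have "distr (density M (indicator (ball z s))) borel f' = density M (indicator (ball y0 s))"
  proof (rule measure_eqI_generator_eq[where E = "Collect open" and \<Omega> = UNIV and A = "\<lambda>_. UNIV"])
    show "Int_stable (Collect open :: 'a set set)" by (auto simp: Int_stable_def)
    fix Y :: "'a set" assume "Y \<in> Collect open"
    then have Yo: "open Y" by simp
    note Y = Yo borel_open[OF Yo]
    have v: "ball z s \<inter> f' -` Y = ball z s \<inter> f -` Y" by (auto simp: f'_def)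
    have im: "f ` (ball z s \<inter> f -` Y) = ball y0 s \<inter> Y" unfolding fi(2)[symmetric] by blast
    have "emeasure M (f ` (ball z s \<inter> f -` Y)) = emeasure M (ball z s \<inter> f -` Y)"
    proof (rule open_isometry_invariant[OF isometric_open_vimage[OF fi(1) Y(1)]])
      show "isometric_on (ball z s \<inter> f -` Y) f" by (rule isometric_on_subset[OF fi(1)]) blast
      show "open (f ` (ball z s \<inter> f -` Y))" unfolding im by (rule open_Int[OF open_ball Y(1)])
    qed
    then show "emeasure (distr (density M (indicator (ball z s))) borel f') Y =
        emeasure (density M (indicator (ball y0 s))) Y"
      using Y by (simp add: eq1 eq2 v im)
  next
    show "emeasure (distr (density M (indicator (ball z s))) borel f') UNIV \<noteq> \<infinity>" for i :: nat
      by (simp add: eq1 emeasure_finite)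
  next
    show "sets (distr (density M (indicator (ball z s))) borel f') = sigma_sets UNIV (Collect open)"
      "sets (density M (indicator (ball y0 s))) = sigma_sets UNIV (Collect open)"
      by (simp_all add: sets_M sets_borel_eq)
  qed simp_all
  then show "emeasure M (ball z s \<inter> f' -` X) = emeasure M (ball y0 s \<inter> X)"
    using eq1[OF X] eq2[OF X] by simp
qed

end

section \<open>Isometric copies have equal measure\<close>

text \<open>Tuples \<open>x\<close> of centres, indexed by the finite set \<open>k\<close>, for which the union of balls
  \<open>moved x\<close> has small diameter and measure at least \<open>c\<close>. Integrating over all such tuples
  replaces averaging over the (here missing) group of translations.\<close>

locale moving_unions = homogeneous_ball_measure y0 s M
  for y0 :: "'a::metric_space" and s and M :: "'a measure" +
  fixes k :: "'a set" and \<delta> \<rho> :: real and c :: ennreal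
  assumes fin: "finite k" and k_sub: "k \<subseteq> ball y0 s" and k_ne: "k \<noteq> {}"
    and \<delta>: "0 < \<delta>" and k_diam: "i \<in> k \<Longrightarrow> j \<in> k \<Longrightarrow> dist i j + \<delta> \<le> \<rho>"
    and small: "\<rho> + 2 * \<delta> < s"
    and big: "c \<le> emeasure M (\<Union>i\<in>k. ball i (\<delta>/2))"
begin

definition moved :: "('a \<Rightarrow> 'a) \<Rightarrow> 'a set" where
  "moved x = (\<Union>i\<in>k. ball (x i) \<delta>)"

definition P :: "('a \<Rightarrow> 'a) measure" where
  "P = PiM k (\<lambda>_. M)"

definition close :: "('a \<Rightarrow> 'a) \<Rightarrow> bool" where
  "close x \<longleftrightarrow> (\<forall>i\<in>k. \<forall>j\<in>k. dist (x i) (x j) < \<rho>)"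

text \<open>The lower bound on the measure is imposed explicitly: a random tuple of centres is not
  an isometric copy of \<open>k\<close>, so its union does not inherit the measure of the original
  one.\<close>

definition admissible :: "('a \<Rightarrow> 'a) set" where
  "admissible = {x \<in> space P. close x \<and> c \<le> emeasure M (moved x)}"

text \<open>Since \<open>P\<close> has total mass 1, this is the probability that the random union
  is admissible and covers \<open>z\<close>.\<close>

definition weight :: "'a \<Rightarrow> ennreal" where
  "weight z = emeasure P {x \<in> admissible. z \<in> moved x}"

sublocale PM: finite_product_sigma_finite "\<lambda>_. M" k
  by standard (rule fin)

sublocale PP: pair_sigma_finite P M
proof -
  have "sigma_finite_measure P" unfolding P_def by (rule PM.sigma_finite_measure_axioms)
  then show "pair_sigma_finite P M"
    by (rule pair_sigma_finite.intro[OF _ sigma_finite_measure_axioms])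
qed

lemma \<rho>_pos: "0 < \<rho>"
proof -
  obtain i where "i \<in> k" using k_ne by blast
  from k_diam[OF this this] \<delta> show ?thesis by simp
qed

lemma space_P: "space P = PiE k (\<lambda>_. UNIV)"
  by (simp add: P_def space_PiM space_M)

lemma measurable_M_borel: "f \<in> measurable N M \<longleftrightarrow> f \<in> borel_measurable N"
  using measurable_cong_sets[OF refl sets_M, of N] by blast

lemma measurable_component: "i \<in> k \<Longrightarrow> (\<lambda>x. x i) \<in> borel_measurable P"
  using measurable_component_singleton[of i k "\<lambda>_. M"] by (simp add: P_def measurable_M_borel)

lemma emeasure_P_PiE:
  "(\<And>i. i \<in> k \<Longrightarrow> A i \<in> sets borel) \<Longrightarrow> emeasure P (PiE k A) = (\<Prod>i\<in>k. emeasure M (A i))"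
  unfolding P_def by (rule PM.measure_times) (simp add: sets_M)

lemma PiE_sets_P: "(\<And>i. i \<in> k \<Longrightarrow> A i \<in> sets borel) \<Longrightarrow> PiE k A \<in> sets P"
  unfolding P_def by (rule sets_PiM_I_finite[OF fin]) (simp add: sets_M)

lemma mem_moved: "z \<in> moved x \<longleftrightarrow> (\<exists>i\<in>k. dist (x i) z < \<delta>)"
  by (simp add: moved_def)

lemma open_moved: "open (moved x)"
  unfolding moved_def by (intro open_UN ballI open_ball)

text \<open>The map \<gamma> makes it possible to count the points of one set by the unions that
  cover their images in another.\<close>

lemma incidence_sets:
  assumes "\<gamma> \<in> borel_measurable borel"
  shows "{w \<in> space (P \<Otimes>\<^sub>M M). \<gamma> (snd w) \<in> moved (fst w)} \<in> sets (P \<Otimes>\<^sub>M M)"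
proof -
  have "(\<lambda>w. \<gamma> (snd w)) \<in> borel_measurable (P \<Otimes>\<^sub>M M)"
    using measurable_compose[OF measurable_snd, of \<gamma> M borel P] assms
      measurable_cong_sets[OF sets_M refl] by blast
  moreover have "(\<lambda>w. fst w i) \<in> borel_measurable (P \<Otimes>\<^sub>M M)" if "i \<in> k" for i
    by (rule measurable_compose[OF measurable_fst measurable_component[OF that]])
  ultimately have "{w \<in> space (P \<Otimes>\<^sub>M M). dist (fst w i) (\<gamma> (snd w)) < \<delta>} \<in> sets (P \<Otimes>\<^sub>M M)"
    if "i \<in> k" for i
    using that by (intro dist_less_sets[OF K]) auto
  then have "(\<Union>i\<in>k. {w \<in> space (P \<Otimes>\<^sub>M M). dist (fst w i) (\<gamma> (snd w)) < \<delta>}) \<in> sets (P \<Otimes>\<^sub>M M)"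
    using fin by (intro sets.finite_UN) auto
  moreover have "(\<Union>i\<in>k. {w \<in> space (P \<Otimes>\<^sub>M M). dist (fst w i) (\<gamma> (snd w)) < \<delta>}) =
      {w \<in> space (P \<Otimes>\<^sub>M M). \<gamma> (snd w) \<in> moved (fst w)}"
    by (auto simp: mem_moved)
  ultimately show ?thesis by simp
qed

lemma measurable_moved: "(\<lambda>x. emeasure M (moved x)) \<in> borel_measurable P"
proof -
  have "{w \<in> space (P \<Otimes>\<^sub>M M). snd w \<in> moved (fst w)} \<in> sets (P \<Otimes>\<^sub>M M)"
    by (rule incidence_sets) simp
  from measurable_emeasure_Pair[OF this]
  show ?thesis
    by (rule measurable_cong[THEN iffD1, rotated])
      (simp add: space_pair_measure space_M vimage_def)
qed

lemma admissible_sets: "admissible \<in> sets P"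
proof -
  have "{x \<in> space P. c \<le> emeasure M (moved x)} \<in> sets P"
    using measurable_moved by (intro borel_measurable_le) auto
  moreover have "{x \<in> space P. close x} \<in> sets P"
    unfolding close_def
    using fin by (intro sets.sets_Collect_finite_All dist_less_sets[OF K] measurable_component)
  moreover have "admissible = {x \<in> space P. close x} \<inter> {x \<in> space P. c \<le> emeasure M (moved x)}"
    by (auto simp: admissible_def)
  ultimately show ?thesis by (simp add: sets.Int)
qed

lemma weight_sets: "{x \<in> admissible. z \<in> moved x} \<in> sets P"
proof -
  have "{x \<in> space P. dist (x i) z < \<delta>} \<in> sets P" if "i \<in> k" for i
    using measurable_component[OF that] by (intro dist_less_sets[OF K]) auto
  then have "admissible \<inter> (\<Union>i\<in>k. {x \<in> space P. dist (x i) z < \<delta>}) \<in> sets P"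
    using fin admissible_sets by (intro sets.Int sets.finite_UN) auto
  moreover have "admissible \<inter> (\<Union>i\<in>k. {x \<in> space P. dist (x i) z < \<delta>}) = {x \<in> admissible. z \<in> moved x}"
    by (auto simp: mem_moved admissible_def)
  ultimately show ?thesis by simp
qed

lemma close_moved_dist:
  assumes "close x" "u \<in> moved x" "v \<in> moved x"
  shows "dist u v < \<rho> + 2 * \<delta>"
proof -
  obtain i j where ij: "i \<in> k" "j \<in> k" "dist (x i) u < \<delta>" "dist (x j) v < \<delta>"
    using assms by (auto simp: mem_moved)
  have "dist (x i) (x j) < \<rho>" using assms(1) ij by (simp add: close_def)
  moreover have "dist u v \<le> dist u (x i) + dist (x i) (x j) + dist (x j) v"
    using dist_triangle[of u v "x i"] dist_triangle[of "x i" v "x j"] by linarith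
  ultimately show ?thesis using ij by (simp add: dist_commute)
qed

lemma finite_P: "emeasure P (space P) = 1"
proof -
  have "emeasure M UNIV = 1" using emeasure_space_1 by (simp add: space_M)
  then show ?thesis using emeasure_P_PiE[of "\<lambda>_. UNIV"] by (simp add: space_P)
qed

lemma weight_finite: "weight z \<le> 1"
proof -
  have "weight z \<le> emeasure P (space P)" unfolding weight_def by (rule emeasure_space)
  then show ?thesis by (simp add: finite_P)
qed

text \<open>Tuples with each centre moved by less than \<delta>/2 form a product of balls of
  positive measure; all of them are admissible and cover \<open>i\<close>. The slack \<delta> in
  \<open>k_diam\<close> pays for the movement.\<close>

lemma weight_pos: 
  assumes i: "i \<in> k"
  shows "0 < weight i"
proof -
  have sub: "PiE k (\<lambda>i. ball i (\<delta>/2)) \<subseteq> {x \<in> admissible. i \<in> moved x}"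
  proof
    fix x assume x: "x \<in> PiE k (\<lambda>i. ball i (\<delta>/2))"
    then have near: "dist j (x j) < \<delta>/2" if "j \<in> k" for j using that by (auto simp: PiE_iff)
    have "close x" unfolding close_def
    proof (intro ballI)
      fix j l assume jl: "j \<in> k" "l \<in> k"
      have "dist (x j) (x l) \<le> dist (x j) j + dist j l + dist l (x l)"
        using dist_triangle[of "x j" "x l" j] dist_triangle[of j "x l" l] by linarith
      then show "dist (x j) (x l) < \<rho>"
        using near[OF jl(1)] near[OF jl(2)] k_diam[OF jl] by (simp add: dist_commute)
    qed
    \<comment> \<open>The radius \<delta> of the moved balls absorbs the displacement, so the bound
      \<open>big\<close> carries over from the original balls of radius \<delta>/2.\<close>
    moreover have "(\<Union>i\<in>k. ball i (\<delta>/2)) \<subseteq> moved x"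
    proof
      fix z assume "z \<in> (\<Union>i\<in>k. ball i (\<delta>/2))"
      then obtain j where j: "j \<in> k" "dist j z < \<delta>/2" by auto
      have "dist (x j) z < \<delta>" using near[OF j(1)] j(2) dist_triangle3[of "x j" z j] by simp
      then show "z \<in> moved x" using j(1) by (auto simp: mem_moved)
    qed
    then have "emeasure M (\<Union>i\<in>k. ball i (\<delta>/2)) \<le> emeasure M (moved x)"
      using open_moved by (intro emeasure_mono) (auto simp: sets_M)
    with big have "c \<le> emeasure M (moved x)" by (rule order_trans)
    moreover have "x \<in> space P" using x by (auto simp: space_P PiE_iff)
    moreover have "i \<in> moved x" using near[OF i] \<delta> i by (auto simp: mem_moved dist_commute intro!: bexI[of _ i])
    ultimately show "x \<in> {x \<in> admissible. i \<in> moved x}" by (simp add: admissible_def)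
  qed
  have "0 < emeasure M (ball j (\<delta>/2))" if "j \<in> k" for j
    using ball_pos[of j "\<delta>/2"] that k_sub \<delta> by auto
  then have "(\<Prod>i\<in>k. emeasure M (ball i (\<delta>/2))) \<noteq> 0"
    using fin by (auto simp: zero_less_iff_neq_zero)
  then have "0 < emeasure P (PiE k (\<lambda>i. ball i (\<delta>/2)))"
    by (subst emeasure_P_PiE) (auto simp: zero_less_iff_neq_zero)
  also have "\<dots> \<le> weight i" unfolding weight_def by (rule emeasure_mono[OF sub weight_sets])
  finally show ?thesis .
qed

text \<open>The isometry from \<open>ball z s\<close> onto \<open>ball y0 s\<close> acts on tuples
  coordinate by coordinate. It preserves the product measure restricted to tuples in these balls,
  and a tuple in \<open>ball z s\<close> is admissible and covers \<open>z\<close> exactly if its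
  image is admissible and covers \<open>y0\<close>.\<close>

lemma weight_invariant:
  assumes z: "z \<in> ball y0 s"
  shows "weight z = weight y0"
proof -
  obtain f where f: "isometry_between (ball z s) (ball y0 s) f" "f z = y0"
    using homogeneous[OF z] by blast
  have fi: "isometric_on (ball z s) f" "f ` ball z s = ball y0 s"
    using f(1) by (auto simp: isometry_between_iff)
  define f' where "f' = (\<lambda>u. if u \<in> ball z s then f u else y0)"
  have f'_meas: "f' \<in> borel_measurable borel"
    unfolding f'_def by (rule restricted_distr_isometry(2)[OF f sets.empty_sets])
  have f'_eq: "emeasure M (ball z s \<inter> f' -` X) = emeasure M (ball y0 s \<inter> X)" if "X \<in> sets borel" for X
    unfolding f'_def by (rule restricted_distr_isometry(1)[OF f that])
  define F where "F = (\<lambda>x. \<lambda>i\<in>k. f' (x i))"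
  define Bz where "Bz = PiE k (\<lambda>_. ball z s)"
  define B0 where "B0 = PiE k (\<lambda>_. ball y0 s)"
  have B_sets: "Bz \<in> sets P" "B0 \<in> sets P" unfolding Bz_def B0_def by (auto intro: PiE_sets_P)
  have F_meas: "F \<in> measurable P P"
  proof -
    have "(\<lambda>x. f' (x i)) \<in> borel_measurable P" if "i \<in> k" for i
      by (rule measurable_compose[OF measurable_component[OF that] f'_meas])
    then show ?thesis unfolding F_def
      by (subst (2) P_def, intro measurable_restrict) (simp add: measurable_M_borel)
  qed
  let ?N = "\<lambda>_::'a. density M (indicator (ball y0 s))"
  \<comment> \<open>Both sides are identified with the product of the restricted measures by
    evaluating them on boxes.\<close>
  have eq: "distr (density P (indicator Bz)) P F = density P (indicator B0)"
  proof -
    have by0: "ball y0 s \<in> sets M" by (simp add: sets_M)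
    interpret N: finite_measure "density M (indicator (ball y0 s))"
      by (rule finite_measureI)
        (use sets.top[of M] in \<open>simp add: emeasure_restricted[OF by0] space_M emeasure_finite\<close>)
    interpret N: product_sigma_finite ?N by standard
    have setsN: "sets (PiM k ?N) = sets P" unfolding P_def by (rule sets_PiM_cong) simp_all
    have N_A: "emeasure (density M (indicator (ball y0 s))) X = emeasure M (ball y0 s \<inter> X)"
      if "X \<in> sets borel" for X
      by (rule emeasure_restricted[OF by0]) (simp add: sets_M that)
    have "distr (density P (indicator Bz)) P F = PiM k ?N"
    proof (rule N.PiM_eqI[OF fin])
      show "sets (distr (density P (indicator Bz)) P F) = sets (PiM k ?N)" by (simp add: setsN)
      fix A assume "\<And>i. i \<in> k \<Longrightarrow> A i \<in> sets (density M (indicator (ball y0 s)))"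
      then have A: "\<And>i. i \<in> k \<Longrightarrow> A i \<in> sets borel" by (simp add: sets_M)
      then have v: "ball z s \<inter> f' -` A i \<in> sets borel" if "i \<in> k" for i
        using measurable_sets[OF f'_meas] that by auto
      have "Bz \<inter> (F -` PiE k A \<inter> space P) = PiE k (\<lambda>i. ball z s \<inter> f' -` A i)"
        by (auto simp: Bz_def F_def PiE_iff space_P)
      moreover have "F -` PiE k A \<inter> space P \<in> sets P"
        by (rule measurable_sets[OF F_meas PiE_sets_P[OF A]])
      ultimately have "emeasure (distr (density P (indicator Bz)) P F) (PiE k A)
          = emeasure P (PiE k (\<lambda>i. ball z s \<inter> f' -` A i))"
        using F_meas PiE_sets_P[OF A] by (simp add: emeasure_distr emeasure_restricted[OF B_sets(1)])
      also have "\<dots> = (\<Prod>i\<in>k. emeasure (density M (indicator (ball y0 s))) (A i))"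
        using A v by (simp add: emeasure_P_PiE f'_eq N_A)
      finally show "emeasure (distr (density P (indicator Bz)) P F) (PiE k A)
          = (\<Prod>i\<in>k. emeasure (density M (indicator (ball y0 s))) (A i))" .
    qed
    moreover have "density P (indicator B0) = PiM k ?N"
    proof (rule N.PiM_eqI[OF fin])
      show "sets (density P (indicator B0)) = sets (PiM k ?N)" by (simp add: setsN)
      fix A assume "\<And>i. i \<in> k \<Longrightarrow> A i \<in> sets (density M (indicator (ball y0 s)))"
      then have A: "\<And>i. i \<in> k \<Longrightarrow> A i \<in> sets borel" by (simp add: sets_M)
      have "B0 \<inter> PiE k A = PiE k (\<lambda>i. ball y0 s \<inter> A i)" by (auto simp: B0_def PiE_iff)
      then have "emeasure (density P (indicator B0)) (PiE k A) = emeasure P (PiE k (\<lambda>i. ball y0 s \<inter> A i))"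
        using PiE_sets_P[OF A] by (simp add: emeasure_restricted[OF B_sets(2)])
      also have "\<dots> = (\<Prod>i\<in>k. emeasure (density M (indicator (ball y0 s))) (A i))"
        using A by (simp add: emeasure_P_PiE N_A)
      finally show "emeasure (density P (indicator B0)) (PiE k A)
          = (\<Prod>i\<in>k. emeasure (density M (indicator (ball y0 s))) (A i))" .
    qed
    ultimately show ?thesis by simp
  qed
  let ?E = "\<lambda>z. {x \<in> admissible. z \<in> moved x}"
  \<comment> \<open>Distances within an admissible union are below \<open>s\<close>, so if it covers
    \<open>u\<close> then all its centres lie in \<open>ball u s\<close>, and restricting to such
    tuples loses nothing.\<close>
  have sub: "x \<in> PiE k (\<lambda>_. ball u s)" if "x \<in> ?E u" for x u
  proof -
    have "dist u (x i) < s" if i: "i \<in> k" for i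
      using close_moved_dist[of x u "x i"] \<open>x \<in> ?E u\<close> i \<delta> small
      by (force simp: admissible_def mem_moved)
    then show ?thesis using that by (auto simp: admissible_def space_P PiE_iff)
  qed
  have equiv: "F x \<in> ?E y0 \<longleftrightarrow> x \<in> ?E z" if x: "x \<in> Bz" for x
  proof -
    have xi: "x i \<in> ball z s" if "i \<in> k" for i using x that by (auto simp: Bz_def)
    have Fx: "F x i = f (x i)" if "i \<in> k" for i using xi[OF that] that by (simp add: F_def f'_def)
    have zz: "z \<in> ball z s" using s by simp
    have cl: "close (F x) \<longleftrightarrow> close x"
      unfolding close_def using Fx isometric_onD[OF fi(1) xi xi] by simp
    have mem: "y0 \<in> moved (F x) \<longleftrightarrow> z \<in> moved x"
      unfolding mem_moved using Fx isometric_onD[OF fi(1) xi zz] f(2) by simp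
    \<comment> \<open>Both unions stay inside the balls between which \<open>f\<close> is an
      isometry, so \<open>f\<close> maps one open union onto the other.\<close>
    have "emeasure M (moved (F x)) = emeasure M (moved x)" if cx: "close x" and zx: "z \<in> moved x"
    proof -
      have sz: "moved x \<subseteq> ball z s" using close_moved_dist[OF cx zx] small by force
      have "close (F x)" "y0 \<in> moved (F x)" using cx zx cl mem by simp_all
      from close_moved_dist[OF this] have s0: "moved (F x) \<subseteq> ball y0 s" using small by force
      have "f ` ball (x i) \<delta> = ball (F x i) \<delta>" if i: "i \<in> k" for i
        unfolding Fx[OF i]
      proof (rule isometry_between_ball_image[OF f(1) _ _ xi[OF i]])
        show "ball (x i) \<delta> \<subseteq> ball z s" using sz i by (auto simp: moved_def)
        have "ball (F x i) \<delta> \<subseteq> moved (F x)" using i by (auto simp: moved_def)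
        then show "ball (f (x i)) \<delta> \<subseteq> ball y0 s" using s0 unfolding Fx[OF i] by (rule order_trans)
      qed
      then have im: "f ` moved x = moved (F x)" unfolding moved_def image_UN by simp
      have "emeasure M (f ` moved x) = emeasure M (moved x)"
        by (rule open_isometry_invariant[OF open_moved isometric_on_subset[OF fi(1) sz]])
          (simp add: im open_moved)
      then show ?thesis by (simp add: im)
    qed
    moreover have "F x \<in> space P" "x \<in> space P"
      using x by (auto simp: F_def space_P PiE_iff Bz_def)
    ultimately show ?thesis using cl mem by (auto simp: admissible_def)
  qed
  have "?E z = Bz \<inter> (F -` ?E y0 \<inter> space P)"
  proof (rule set_eqI)
    fix x
    have "?E z \<subseteq> Bz" using sub unfolding Bz_def by (rule subsetI)
    moreover have "?E z \<subseteq> space P" by (auto simp: admissible_def)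
    ultimately show "x \<in> ?E z \<longleftrightarrow> x \<in> Bz \<inter> (F -` ?E y0 \<inter> space P)"
      using equiv[of x] unfolding Int_iff vimage_eq by blast
  qed
  moreover have "F -` ?E y0 \<inter> space P \<in> sets P" by (rule measurable_sets[OF F_meas weight_sets])
  ultimately have "weight z = emeasure (distr (density P (indicator Bz)) P F) (?E y0)"
    unfolding weight_def using F_meas weight_sets[of y0]
    by (simp add: emeasure_distr emeasure_restricted[OF B_sets(1)])
  also have "\<dots> = emeasure P (B0 \<inter> ?E y0)"
    unfolding eq by (rule emeasure_restricted[OF B_sets(2) weight_sets])
  also have "B0 \<inter> ?E y0 = ?E y0" using sub[of _ y0] unfolding B0_def by blast
  finally show ?thesis unfolding weight_def .
qed

lemma weight_y0: "0 < weight y0" "weight y0 \<noteq> \<infinity>"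
proof -
  obtain i where i: "i \<in> k" using k_ne by blast
  show "0 < weight y0" using weight_pos[OF i] weight_invariant[of i] i k_sub by auto
  show "weight y0 \<noteq> \<infinity>" using weight_finite[of y0] by (auto simp: top_unique)
qed

text \<open>Fubini for the pairs of an admissible tuple and a point of \<open>D\<close> whose image
  it covers. Slicing by points gives the constant weight, since \<gamma> maps \<open>D\<close> into
  the homogeneous ball.\<close>

lemma incidence_double_count:
  assumes \<gamma>: "\<gamma> \<in> borel_measurable borel" and D: "D \<in> sets borel" "\<gamma> ` D \<subseteq> ball y0 s"
  defines "Q \<equiv> {w \<in> space (P \<Otimes>\<^sub>M M). fst w \<in> admissible \<and> snd w \<in> D \<and> \<gamma> (snd w) \<in> moved (fst w)}"
  shows "(\<integral>\<^sup>+x. emeasure M {b \<in> D. x \<in> admissible \<and> \<gamma> b \<in> moved x} \<partial>P) = weight y0 * emeasure M D"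
    and "(\<lambda>x. emeasure M {b \<in> D. x \<in> admissible \<and> \<gamma> b \<in> moved x}) \<in> borel_measurable P"
    and "\<And>x. x \<in> admissible \<Longrightarrow> {b \<in> D. \<gamma> b \<in> moved x} \<in> sets borel"
proof -
  have sp: "space (P \<Otimes>\<^sub>M M) = space P \<times> UNIV" by (simp add: space_pair_measure space_M)
  have Q: "Q \<in> sets (P \<Otimes>\<^sub>M M)"
  proof -
    have "admissible \<times> D \<in> sets (P \<Otimes>\<^sub>M M)"
      using admissible_sets D(1) by (intro pair_measureI) (auto simp: sets_M)
    moreover have "Q = (admissible \<times> D) \<inter> {w \<in> space (P \<Otimes>\<^sub>M M). \<gamma> (snd w) \<in> moved (fst w)}"
      unfolding Q_def sp by (auto simp: admissible_def)
    ultimately show ?thesis using incidence_sets[OF \<gamma>] by (simp add: sets.Int)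
  qed
  have sec: "Pair x -` Q = {b \<in> D. x \<in> admissible \<and> \<gamma> b \<in> moved x}" for x
    unfolding Q_def sp by (auto simp: admissible_def)
  have sec2: "(\<lambda>x. (x, b)) -` Q = (if b \<in> D then {x \<in> admissible. \<gamma> b \<in> moved x} else {})" for b
    unfolding Q_def sp by (auto simp: admissible_def)
  show "(\<lambda>x. emeasure M {b \<in> D. x \<in> admissible \<and> \<gamma> b \<in> moved x}) \<in> borel_measurable P"
    using measurable_emeasure_Pair[OF Q] by (simp add: sec)
  show "{b \<in> D. \<gamma> b \<in> moved x} \<in> sets borel" if "x \<in> admissible" for x
    using sets_Pair1[OF Q, of x] that by (simp add: sec sets_M)
  have "(\<integral>\<^sup>+x. emeasure M {b \<in> D. x \<in> admissible \<and> \<gamma> b \<in> moved x} \<partial>P) = emeasure (P \<Otimes>\<^sub>M M) Q"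
    by (simp add: emeasure_pair_measure_alt[OF Q] sec)
  also have "\<dots> = (\<integral>\<^sup>+b. emeasure P ((\<lambda>x. (x, b)) -` Q) \<partial>M)" by (rule PP.emeasure_pair_measure_alt2[OF Q])
  also have "\<dots> = (\<integral>\<^sup>+b. weight y0 * indicator D b \<partial>M)"
  proof (rule nn_integral_cong)
    fix b
    show "emeasure P ((\<lambda>x. (x, b)) -` Q) = weight y0 * indicator D b"
    proof (cases "b \<in> D")
      case True
      then have "weight (\<gamma> b) = weight y0" using D(2) by (intro weight_invariant) auto
      then show ?thesis using True by (simp add: sec2 weight_def)
    qed (simp add: sec2)
  qed
  also have "\<dots> = weight y0 * emeasure M D"
    using D(1) by (intro nn_integral_cmult_indicator) (simp add: sets_M)
  finally show "(\<integral>\<^sup>+x. emeasure M {b \<in> D. x \<in> admissible \<and> \<gamma> b \<in> moved x} \<partial>P) = weight y0 * emeasure M D" .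
qed

end

text \<open>A finite net of the whole space need not have its centres in \<open>S\<close>; each
  centre whose ball meets \<open>S\<close> is replaced by a point of \<open>S\<close> in that ball,
  which doubles the radius.\<close>

lemma finite_net_in_subset:
  fixes S :: "'a::metric_space set"
  assumes K: "compact (UNIV :: 'a set)" and e: "0 < e"
  obtains k where "finite k" "k \<subseteq> S" "S \<subseteq> (\<Union>i\<in>k. ball i e)"
proof -
  have "0 < e / 2" using e by simp
  with seq_compact_imp_totally_bounded[OF compact_imp_seq_compact[OF K]]
  obtain k0 :: "'a set" where k0: "finite k0" "UNIV \<subseteq> (\<Union>x\<in>k0. ball x (e/2))" by blast
  define k1 where "k1 = {x \<in> k0. ball x (e/2) \<inter> S \<noteq> {}}"
  have "\<forall>x\<in>k1. \<exists>p. p \<in> ball x (e/2) \<inter> S" by (auto simp: k1_def)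
  then obtain p where p: "\<And>x. x \<in> k1 \<Longrightarrow> p x \<in> ball x (e/2) \<inter> S" by metis
  show thesis
  proof (rule that[of "p ` k1"])
    show "finite (p ` k1)" using k0(1) by (simp add: k1_def)
    show "p ` k1 \<subseteq> S" using p by blast
    show "S \<subseteq> (\<Union>i\<in>p ` k1. ball i e)"
    proof
      fix z assume z: "z \<in> S"
      obtain x where x: "x \<in> k0" "z \<in> ball x (e/2)" using k0(2) by blast
      then have x1: "x \<in> k1" using z by (auto simp: k1_def)
      have "dist (p x) z \<le> dist x (p x) + dist x z" by (rule dist_triangle3)
      then have "z \<in> ball (p x) e" using p[OF x1] x(2) by simp
      then show "z \<in> (\<Union>i\<in>p ` k1. ball i e)" using x1 by blast
    qed
  qed
qed

section \<open>Small sets and the comparison of isometric copies\<close>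

context homogeneous_ball_measure
begin

text \<open>The bound \<open>d\<close> on distances is strictly below \<open>r\<close>; the gap
  leaves room to thicken the set without reaching \<open>r\<close>.\<close>

definition small_sets :: "real \<Rightarrow> 'a set set" where
  "small_sets r = {S \<in> sets borel. S \<subseteq> ball y0 s \<and> (\<exists>d<r. \<forall>u\<in>S. \<forall>v\<in>S. dist u v \<le> d)}"

definition max_measure :: "real \<Rightarrow> ennreal" where
  "max_measure r = (SUP S\<in>small_sets r. emeasure M S)"

lemma max_measure_ge: "S \<in> small_sets r \<Longrightarrow> emeasure M S \<le> max_measure r"
  unfolding max_measure_def by (rule SUP_upper)

lemma max_measure_bounds:
  assumes r: "0 < r"
  shows "max_measure r \<noteq> 0" "max_measure r \<noteq> \<infinity>"
proof -
  have "max_measure r \<le> 1" unfolding max_measure_def by (rule SUP_least) (rule measure_le_1)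
  then show "max_measure r \<noteq> \<infinity>" by (auto simp: top_unique)
  define t where "t = min (r/4) s"
  have t: "0 < t" "4 * t \<le> r" "t \<le> s" using r s by (auto simp: t_def)
  have "dist u v \<le> 2 * t" if "u \<in> ball y0 t" "v \<in> ball y0 t" for u v
    using that dist_triangle3[of u v y0] by simp
  moreover have "2 * t < r" using t by simp
  ultimately have "ball y0 t \<in> small_sets r"
    using subset_ball[OF t(3), of y0] unfolding small_sets_def by (auto intro!: exI[of _ "2 * t"])
  from max_measure_ge[OF this] ball_y0_pos[OF t(1)] show "max_measure r \<noteq> 0" by auto
qed

text \<open>For each small set \<open>S\<close>, incidences with random admissible unions of measure
  at least that of \<open>S\<close> are counted. A union that meets the image of \<open>B\<close>
  lies in the \<open>r\<close>-neighbourhood of that image, while the part of \<open>B\<close>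
  mapped into it is itself a small set. Integrating, cancelling the weight and taking the supremum
  over \<open>S\<close> gives the bound.\<close>

lemma isometric_copy_le_neighbourhood:
  assumes B: "closed B" "B \<subseteq> ball y0 s" and g: "isometric_on B g"
    and r: "0 < r" "r < s" and A: "(\<Union>b\<in>B. ball (g b) r) \<subseteq> ball y0 s"
  shows "emeasure M B \<le> emeasure M (\<Union>b\<in>B. ball (g b) r)"
proof -
  define A where "A = (\<Union>b\<in>B. ball (g b) r)"
  have A_sub: "A \<subseteq> ball y0 s" using assms by (simp add: A_def)
  have A_sets: "A \<in> sets borel" unfolding A_def by (intro borel_open open_UN ballI open_ball)
  have B_sets: "B \<in> sets borel" using B(1) by (rule borel_closed)
  define g' where "g' = (\<lambda>b. if b \<in> B then g b else y0)"
  have g'_meas: "g' \<in> borel_measurable borel"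
    unfolding g'_def using isometric_on_continuous[OF g] B_sets
    by (intro borel_measurable_continuous_on_if) auto
  have g'_A: "ball (g' b) r \<subseteq> A" if "b \<in> B" for b using that by (auto simp: g'_def A_def)
  have g'_sub: "g' ` B \<subseteq> ball y0 s"
  proof
    fix z assume "z \<in> g' ` B"
    then obtain b where b: "b \<in> B" "z = g' b" by blast
    have "z \<in> ball (g' b) r" using b(2) r(1) by simp
    then show "z \<in> ball y0 s" using g'_A[OF b(1)] A_sub by blast
  qed
  have main: "emeasure M S * emeasure M B \<le> max_measure r * emeasure M A" if S: "S \<in> small_sets r" for S
  proof (cases "S = {}")
    case False
    obtain d where d: "d < r" "\<And>u v. u \<in> S \<Longrightarrow> v \<in> S \<Longrightarrow> dist u v \<le> d"
      using S by (auto simp: small_sets_def)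
    \<comment> \<open>With \<rho> equal to \<open>d + \<delta>\<close>, distances within an
      admissible union are below \<open>d + 3 * \<delta>\<close>, one \<delta> short of
      \<open>r\<close>.\<close>
    define \<delta> where "\<delta> = (r - d) / 4"
    have delta: "0 < \<delta>" "d + 4 * \<delta> = r" using d(1) by (simp_all add: \<delta>_def field_simps)
    have "0 < \<delta> / 2" using delta(1) by simp
    then obtain k where k: "finite k" "k \<subseteq> S" "S \<subseteq> (\<Union>i\<in>k. ball i (\<delta>/2))"
      by (rule finite_net_in_subset[OF K])
    interpret moving_unions y0 s M k \<delta> "d + \<delta>" "emeasure M S"
    proof
      show "finite k" by fact
      show "k \<subseteq> ball y0 s" using k(2) S by (auto simp: small_sets_def)
      show "k \<noteq> {}" using k(3) False by auto
      show "0 < \<delta>" by fact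
      show "dist i j + \<delta> \<le> d + \<delta>" if "i \<in> k" "j \<in> k" for i j using d(2) that k(2) by auto
      show "d + \<delta> + 2 * \<delta> < s" using delta r by linarith
      show "emeasure M S \<le> emeasure M (\<Union>i\<in>k. ball i (\<delta>/2))"
        using k(3) by (intro emeasure_mono) (simp_all add: sets_M borel_open open_UN)
    qed
    have cB: "\<And>x. x \<in> admissible \<Longrightarrow> {b \<in> B. g' b \<in> moved x} \<in> sets borel"
      by (rule incidence_double_count(3)[OF g'_meas B_sets g'_sub])
    have ptw: "emeasure M S * emeasure M {b \<in> B. x \<in> admissible \<and> g' b \<in> moved x}
        \<le> max_measure r * emeasure M {z \<in> A. x \<in> admissible \<and> z \<in> moved x}" for x
    proof (cases "\<exists>b\<in>B. x \<in> admissible \<and> g' b \<in> moved x")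
      case True
      then obtain b where b: "b \<in> B" "x \<in> admissible" "g' b \<in> moved x" by blast
      have x: "close x" "emeasure M S \<le> emeasure M (moved x)" using b(2) by (simp_all add: admissible_def)
      have "z \<in> A" if "z \<in> moved x" for z
      proof -
        have "dist (g' b) z < r" using close_moved_dist[OF x(1) b(3) that] delta by linarith
        then show ?thesis using g'_A[OF b(1)] by auto
      qed
      then have mv: "{z \<in> A. x \<in> admissible \<and> z \<in> moved x} = moved x" using b(2) by blast
      have "emeasure M {b \<in> B. x \<in> admissible \<and> g' b \<in> moved x} \<le> max_measure r"
      proof (rule max_measure_ge)
        have "dist u v \<le> d + 3 * \<delta>" if "u \<in> B" "v \<in> B" "g' u \<in> moved x" "g' v \<in> moved x" for u v
          using close_moved_dist[OF x(1) that(3,4)] isometric_onD[OF g that(1,2)] that(1,2)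
          by (simp add: g'_def)
        moreover have "d + 3 * \<delta> < r" using delta by linarith
        ultimately show "{b \<in> B. x \<in> admissible \<and> g' b \<in> moved x} \<in> small_sets r"
          using cB[OF b(2)] B(2) b(2) unfolding small_sets_def
          by (auto intro!: exI[of _ "d + 3 * \<delta>"])
      qed
      then show ?thesis
        unfolding mv by (subst mult.commute) (intro mult_mono x(2) zero_le)
    next
      case False
      then have no: "{b \<in> B. x \<in> admissible \<and> g' b \<in> moved x} = {}" by blast
      show ?thesis unfolding no by simp
    qed
    \<comment> \<open>The second count uses the identity in place of \<open>g'\<close>, so that it
      measures the neighbourhood itself.\<close>
    have idA: "(\<lambda>z. z) ` A \<subseteq> ball y0 s" using A_sub by simp
    have id: "(\<lambda>z::'a. z) \<in> borel_measurable borel" by simp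
    note dB = incidence_double_count[OF g'_meas B_sets g'_sub]
    note dA = incidence_double_count[OF id A_sets idA]
    have "weight y0 * (emeasure M S * emeasure M B) = emeasure M S * (weight y0 * emeasure M B)"
      by (simp add: ac_simps)
    also have "\<dots> = (\<integral>\<^sup>+x. emeasure M S * emeasure M {b \<in> B. x \<in> admissible \<and> g' b \<in> moved x} \<partial>P)"
      unfolding dB(1)[symmetric] by (rule nn_integral_cmult[symmetric, OF dB(2)])
    also have "\<dots> \<le> (\<integral>\<^sup>+x. max_measure r * emeasure M {z \<in> A. x \<in> admissible \<and> z \<in> moved x} \<partial>P)"
      by (rule nn_integral_mono) (rule ptw)
    also have "\<dots> = max_measure r * (weight y0 * emeasure M A)"
      unfolding dA(1)[symmetric] by (rule nn_integral_cmult[OF dA(2)])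
    also have "\<dots> = weight y0 * (max_measure r * emeasure M A)" by (simp add: ac_simps)
    finally show ?thesis
      using weight_y0 by (simp add: ennreal_mult_le_mult_iff)
  qed simp
  \<comment> \<open>Letting \<open>S\<close> run over all small sets replaces its measure by the
    supremum, a finite non-zero factor that cancels.\<close>
  have "max_measure r * emeasure M B = (SUP S\<in>small_sets r. emeasure M S * emeasure M B)"
    unfolding max_measure_def by (rule SUP_mult_right_ennreal)
  also have "\<dots> \<le> max_measure r * emeasure M A" using main by (rule SUP_least)
  finally show ?thesis
    using max_measure_bounds[OF r(1)] by (simp add: ennreal_mult_le_mult_iff A_def)
qed

text \<open>The radius of the neighbourhoods tends to 0, and they decrease to the image of
  \<open>B\<close>, which is compact and hence closed.\<close>

lemma compact_isometric_copy_le: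
  assumes B: "compact B" "B \<subseteq> ball y0 s" and g: "isometric_on B g" "g ` B \<subseteq> ball y0 s"
  shows "emeasure M B \<le> emeasure M (g ` B)"
proof -
  define A where "A n = (\<Union>b\<in>B. ball (g b) (1 / real (Suc n)))" for n
  have gB: "compact (g ` B)" by (rule compact_isometric_image[OF g(1) B(1)])
  obtain e where "0 < e" and e0: "\<And>x. x \<in> g ` B \<Longrightarrow> \<exists>G\<in>{ball y0 s}. ball x e \<subseteq> G"
    using Heine_Borel_lemma[OF gB, of "{ball y0 s}"] g(2) by (metis Union_insert Union_empty open_ball singletonD sup_bot_right)
  then have e: "0 < e" "\<And>b. b \<in> B \<Longrightarrow> ball (g b) e \<subseteq> ball y0 s" by simp_all
  have "0 < min e s" using e(1) s by simp
  \<comment> \<open>From \<open>N\<close> on, the neighbourhoods lie in \<open>ball y0 s\<close> and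
    their radius is below \<open>s\<close>.\<close>
  then obtain N where N: "1 / real (Suc N) < min e s" by (rule nat_approx_posE)
  have le: "emeasure M B \<le> emeasure M (A (n + N))" for n
  proof -
    have "1 / real (Suc (n + N)) \<le> 1 / real (Suc N)" by (rule divide_left_mono) auto
    then have n: "1 / real (Suc (n + N)) < s" "1 / real (Suc (n + N)) \<le> e" using N by linarith+
    have "A (n + N) \<subseteq> ball y0 s"
      unfolding A_def by (intro UN_least order_trans[OF subset_ball[OF n(2)] e(2)])
    then show ?thesis
      unfolding A_def using B n(1)
      by (intro isometric_copy_le_neighbourhood compact_imp_closed g) auto
  qed
  have dec: "A m \<subseteq> A n" if "n \<le> m" for m n
  proof -
    have "1 / real (Suc m) \<le> 1 / real (Suc n)" using that by (intro divide_left_mono) auto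
    from subset_ball[OF this] show ?thesis unfolding A_def by blast
  qed
  have "(\<lambda>n. emeasure M (A (n + N))) \<longlonglongrightarrow> emeasure M (\<Inter>n. A (n + N))"
  proof (rule Lim_emeasure_decseq)
    show "range (\<lambda>n. A (n + N)) \<subseteq> sets M"
      unfolding sets_M A_def by (auto intro!: borel_open open_UN)
    show "decseq (\<lambda>n. A (n + N))" using dec by (intro decseq_SucI) simp
  qed (simp add: emeasure_finite)
  moreover have "(\<Inter>n. A (n + N)) = g ` B"
  proof
    show "g ` B \<subseteq> (\<Inter>n. A (n + N))" by (auto simp: A_def intro!: bexI)
    show "(\<Inter>n. A (n + N)) \<subseteq> g ` B"
    proof
      fix z assume z: "z \<in> (\<Inter>n. A (n + N))"
      show "z \<in> g ` B"
      proof (rule ccontr)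
        assume "z \<notin> g ` B"
        then have "z \<in> - g ` B" by simp
        moreover have "open (- g ` B)" using compact_imp_closed[OF gB] by (simp add: open_Compl)
        ultimately obtain t where t: "0 < t" "ball z t \<subseteq> - g ` B" by (meson openE)
        obtain n where n: "1 / real (Suc n) < t" by (rule nat_approx_posE[OF t(1)])
        have "z \<in> A n" using z dec[of n "n + N"] by auto
        then obtain b where "b \<in> B" "dist (g b) z < 1 / real (Suc n)" by (auto simp: A_def)
        then have "g b \<in> ball z t" "b \<in> B" using n by (auto simp: dist_commute)
        then show False using t(2) by blast
      qed
    qed
  qed
  ultimately have "(\<lambda>n. emeasure M (A (n + N))) \<longlonglongrightarrow> emeasure M (g ` B)" by simp
  then show ?thesis using le by (intro LIMSEQ_le_const) auto
qed

text \<open>The comparison is applied to \<open>g\<close> and to its inverse. In contrast to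
  \<open>open_isometry_invariant\<close>, it reaches sets without interior.\<close>

theorem compact_isometric_copy_eq:
  assumes B: "compact B" "B \<subseteq> ball y0 s" and g: "isometric_on B g" "g ` B \<subseteq> ball y0 s"
  shows "emeasure M (g ` B) = emeasure M B"
proof (rule antisym)
  show "emeasure M B \<le> emeasure M (g ` B)" by (rule compact_isometric_copy_le[OF assms])
  have im: "inv_into B g ` g ` B = B" using isometric_on_inj[OF g(1)] by (simp add: inv_into_image_cancel)
  have "emeasure M (g ` B) \<le> emeasure M (inv_into B g ` g ` B)"
    by (rule compact_isometric_copy_le[OF compact_isometric_image[OF g(1) B(1)] g(2) isometric_on_inv[OF g(1)]])
      (simp add: im B(2))
  then show "emeasure M (g ` B) \<le> emeasure M B" by (simp add: im)
qed

end

section \<open>Gluing charts\<close>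

text \<open>Writing images under \<open>f\<close> as preimages under a Borel map makes them
  measurable and turns the measure of an image into a distribution. The default value outside the
  image of \<open>C\<close> is cut off by the intersection.\<close>

lemma isometric_inverse_extension:
  fixes C :: "'a::metric_space set" and f :: "'a \<Rightarrow> 'a"
  assumes C: "compact C" and f: "isometric_on C f"
  obtains h where "h \<in> borel_measurable borel" "\<And>X. f ` (C \<inter> X) = f ` C \<inter> h -` X"
proof -
  have fC: "f ` C \<in> sets borel"
    by (intro borel_closed compact_imp_closed compact_isometric_image[OF f C])
  define h where "h = (\<lambda>y. if y \<in> f ` C then inv_into C f y else undefined)"
  have "h \<in> borel_measurable borel"
    unfolding h_def using isometric_on_continuous[OF isometric_on_inv[OF f]] fC
    by (intro borel_measurable_continuous_on_if) auto
  moreover have "f ` (C \<inter> X) = f ` C \<inter> h -` X" for X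
    using isometric_on_inj[OF f] by (auto simp: h_def)
  ultimately show thesis by (rule that)
qed

lemma isometric_image_borel:
  fixes C :: "'a::metric_space set" and f :: "'a \<Rightarrow> 'a"
  assumes C: "compact C" and f: "isometric_on C f" and X: "X \<in> sets borel" "X \<subseteq> C"
  shows "f ` X \<in> sets borel"
proof -
  obtain h where h: "h \<in> borel_measurable borel" "\<And>X. f ` (C \<inter> X) = f ` C \<inter> h -` X"
    using isometric_inverse_extension[OF C f] by blast
  have "C \<inter> X = X" using X(2) by blast
  then have "f ` X = f ` C \<inter> h -` X" using h(2)[of X] by simp
  moreover have "f ` C \<in> sets borel"
    by (intro borel_closed compact_imp_closed compact_isometric_image[OF f C])
  moreover have "h -` X \<in> sets borel" using measurable_sets[OF h(1) X(1)] by simp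
  ultimately show ?thesis by simp
qed

text \<open>Two finite measures, one of them transported by the inverse of \<open>f\<close>, agree
  on closed sets, because these meet \<open>C\<close> in compact sets; closed sets are stable under
  intersection and generate the Borel sets.\<close>

lemma isometric_image_measure_eqI:
  fixes C :: "'a::metric_space set" and f :: "'a \<Rightarrow> 'a"
  assumes sets: "sets M = sets borel" and fin: "emeasure M UNIV \<noteq> \<infinity>"
    and C: "compact C" and f: "isometric_on C f"
    and eq: "\<And>X. compact X \<Longrightarrow> X \<subseteq> C \<Longrightarrow> emeasure M (f ` X) = emeasure M X"
    and X: "X \<in> sets borel" "X \<subseteq> C"
  shows "emeasure M (f ` X) = emeasure M X"
proof -
  obtain h where h: "h \<in> borel_measurable borel" "\<And>X. f ` (C \<inter> X) = f ` C \<inter> h -` X"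
    using isometric_inverse_extension[OF C f] by blast
  have space: "space M = UNIV" using sets_eq_imp_space_eq[OF sets] by simp
  have C_sets: "C \<in> sets M" "f ` C \<in> sets M"
    unfolding sets by (intro borel_closed compact_imp_closed C compact_isometric_image[OF f C])+
  let ?M1 = "density M (indicator C)" and ?M2 = "distr (density M (indicator (f ` C))) borel h"
  have M1: "emeasure ?M1 Y = emeasure M (C \<inter> Y)" if "Y \<in> sets borel" for Y
    using that by (simp add: emeasure_restricted[OF C_sets(1)] sets)
  have M2: "emeasure ?M2 Y = emeasure M (f ` (C \<inter> Y))" if Y: "Y \<in> sets borel" for Y
  proof -
    have "h \<in> borel_measurable M"
      using h(1) measurable_cong_sets[OF sets refl, of borel] by blast
    then have "h \<in> measurable (density M (indicator (f ` C))) borel" by simp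
    moreover have "h -` Y \<in> sets M" using measurable_sets[OF h(1) Y] by (simp add: sets)
    ultimately show ?thesis
      using Y by (simp add: emeasure_distr space emeasure_restricted[OF C_sets(2)] h(2))
  qed
  have "?M1 = ?M2"
  proof (rule measure_eqI_generator_eq[where E = "Collect closed" and \<Omega> = UNIV and A = "\<lambda>_. UNIV"])
    show "Int_stable (Collect closed :: 'a set set)" by (auto simp: Int_stable_def)
    fix Y :: "'a set" assume "Y \<in> Collect closed"
    then have Y: "closed Y" by simp
    have "emeasure M (f ` (C \<inter> Y)) = emeasure M (C \<inter> Y)"
      by (rule eq[OF compact_Int_closed[OF C Y] Int_lower1])
    then show "emeasure ?M1 Y = emeasure ?M2 Y" by (simp add: M1 M2 borel_closed[OF Y])
  next
    have "emeasure M C \<noteq> \<infinity>"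
      using emeasure_mono[OF subset_UNIV, of M C] fin sets.top[of M] by (auto simp: space top_unique)
    then show "emeasure ?M1 UNIV \<noteq> \<infinity>" for i :: nat by (simp add: M1)
  next
    have "sets (borel :: 'a measure) = sigma_sets UNIV (Collect closed)"
      unfolding borel_eq_closed by (rule sets_measure_of) simp
    then show "sets ?M1 = sigma_sets UNIV (Collect closed)" "sets ?M2 = sigma_sets UNIV (Collect closed)"
      by (simp_all add: sets)
  qed simp_all
  moreover have "C \<inter> X = X" using X(2) by blast
  ultimately show ?thesis using M1[OF X(1)] M2[OF X(1)] by simp
qed

text \<open>By injectivity of \<open>f\<close> a partition of \<open>C\<close> becomes a partition
  of its image, so invariance can be checked piece by piece.\<close>

lemma isometric_image_measure_eq_partition:
  fixes C :: "'a::metric_space set" and f :: "'a \<Rightarrow> 'a" and n :: nat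
  assumes sets: "sets M = sets borel"
    and C: "compact C" and f: "isometric_on C f"
    and R: "\<And>i. i < n \<Longrightarrow> R i \<in> sets borel" "disjoint_family_on R {..<n}" "(\<Union>i<n. R i) = C"
    and eq: "\<And>i. i < n \<Longrightarrow> emeasure M (f ` R i) = emeasure M (R i)"
  shows "emeasure M (f ` C) = emeasure M C"
proof -
  have sub: "R i \<subseteq> C" if "i < n" for i using R(3) that by blast
  have im: "f ` R i \<in> sets borel" if "i < n" for i
    by (rule isometric_image_borel[OF C f R(1)[OF that] sub[OF that]])
  have dis: "disjoint_family_on (\<lambda>i. f ` R i) {..<n}"
    unfolding disjoint_family_on_def
  proof (intro ballI impI)
    fix i j assume ij: "i \<in> {..<n}" "j \<in> {..<n}" "i \<noteq> j"
    then have "R i \<inter> R j = {}" using R(2) by (simp add: disjoint_family_on_def)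
    moreover have "f ` R i \<inter> f ` R j = f ` (R i \<inter> R j)"
      using inj_on_image_Int[OF isometric_on_inj[OF f] sub sub] ij by simp
    ultimately show "f ` R i \<inter> f ` R j = {}" by simp
  qed
  have "emeasure M (f ` C) = (\<Sum>i<n. emeasure M (f ` R i))"
    unfolding R(3)[symmetric] image_UN using im dis by (intro sum_emeasure[symmetric]) (auto simp: sets)
  also have "\<dots> = (\<Sum>i<n. emeasure M (R i))" by (rule sum.cong) (simp_all add: eq)
  also have "\<dots> = emeasure M C"
    unfolding R(3)[symmetric] using R(1,2) by (intro sum_emeasure) (auto simp: sets)
  finally show ?thesis .
qed

text \<open>\<open>W n\<close> collects the points at distance at least \<open>1 / Suc n\<close>
  from every point outside \<open>U\<close>, so its complement is a union of open balls.\<close>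

lemma compact_exhaustion_of_open:
  fixes U :: "'a::metric_space set"
  assumes "open U"
  defines "W \<equiv> \<lambda>n. {x. ball x (1 / real (Suc n)) \<subseteq> U}"
  shows "closed (W n)" "incseq W" "(\<Union>n. W n) = U"
proof -
  have "- W n = (\<Union>y\<in>-U. ball y (1 / real (Suc n)))" by (auto simp: W_def subset_iff dist_commute)
  then have "open (- W n)" by (simp add: open_UN)
  then show "closed (W n)" by (simp add: closed_def)
  have "W m \<subseteq> W n" if "m \<le> n" for m n
  proof -
    have "1 / real (Suc n) \<le> 1 / real (Suc m)" using that by (intro divide_left_mono) auto
    from subset_ball[OF this] show ?thesis unfolding W_def by blast
  qed
  then show "incseq W" by (rule monoI)
  show "(\<Union>n. W n) = U"
  proof
    have "x \<in> U" if "x \<in> W n" for x n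
      using that centre_in_ball[of x "1 / real (Suc n)"] by (auto simp: W_def simp del: centre_in_ball)
    then show "(\<Union>n. W n) \<subseteq> U" by blast
    show "U \<subseteq> (\<Union>n. W n)"
    proof
      fix x assume "x \<in> U"
      then obtain e where e: "0 < e" "ball x e \<subseteq> U" using assms(1) open_contains_ball by blast
      obtain n where "1 / real (Suc n) < e" by (rule nat_approx_posE[OF e(1)])
      then have "ball x (1 / real (Suc n)) \<subseteq> ball x e" by (intro subset_ball) simp
      then have "x \<in> W n" using e(2) unfolding W_def by blast
      then show "x \<in> (\<Union>n. W n)" by blast
    qed
  qed
qed

text \<open>The domains are compact so that the comparison of compact isometric copies applies to
  changes of chart. Indices from \<open>n\<close> on carry empty domains, because
  \<open>disjointed\<close> works with infinite sequences.\<close>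

locale glued_charts = homogeneous_ball_measure y0 s M
  for y0 :: "'a::metric_space" and s and M :: "'a measure" +
  fixes n :: nat and Q :: "nat \<Rightarrow> 'a set" and h :: "nat \<Rightarrow> 'a \<Rightarrow> 'a"
  assumes Q: "compact (Q i)" and h: "isometric_on (Q i) (h i)" "h i ` Q i \<subseteq> ball y0 s"
    and Q_cover: "(\<Union>i<n. Q i) = UNIV" and Q_ge: "n \<le> i \<Longrightarrow> Q i = {}"
begin

definition cell :: "nat \<Rightarrow> 'a set" where
  "cell = disjointed Q"

text \<open>Each cell is measured through its own chart; \<open>glued_eq_chart\<close> shows that
  any other chart gives the same value.\<close>

definition glue :: "'a set \<Rightarrow> ennreal" where
  "glue X = (\<Sum>i<n. emeasure M (h i ` (X \<inter> cell i)))"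

definition glued :: "'a measure" where
  "glued = measure_of UNIV (sets borel) glue"

lemma Q_sets: "Q i \<in> sets borel"
  by (intro borel_closed compact_imp_closed Q)

lemma cell_sub: "cell i \<subseteq> Q i"
  unfolding cell_def by (rule disjointed_subset)

lemma cell_sets: "cell i \<in> sets borel"
proof -
  have "range Q \<subseteq> sets borel" using Q_sets by blast
  from sets.range_disjointed_sets[OF this] show ?thesis unfolding cell_def by blast
qed

lemma cell_disjoint: "disjoint_family cell"
  unfolding cell_def by (rule disjoint_family_disjointed)

lemma cell_cover: "(\<Union>i<n. cell i) = UNIV"
proof -
  have "x \<in> (\<Union>i<n. cell i)" for x
  proof -
    have "x \<in> (\<Union>i<n. Q i)" by (simp only: Q_cover UNIV_I)
    then have "x \<in> (\<Union>i. cell i)" unfolding cell_def UN_disjointed_eq by blast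
    then obtain i where i: "x \<in> cell i" by blast
    have "i < n"
    proof (rule ccontr)
      assume "\<not> i < n"
      then have "Q i = {}" by (intro Q_ge) simp
      then show False using i cell_sub[of i] by blast
    qed
    with i show ?thesis by blast
  qed
  then show ?thesis by blast
qed

lemma chart_image_sets:
  assumes "X \<in> sets borel" "X \<subseteq> Q i"
  shows "h i ` X \<in> sets M"
  unfolding sets_M by (rule isometric_image_borel[OF Q h(1) assms])

lemma glue_countably_additive:
  fixes A :: "nat \<Rightarrow> 'a set"
  assumes A: "range A \<subseteq> sets borel" and dis: "disjoint_family A"
  shows "(\<Sum>k. glue (A k)) = glue (\<Union>k. A k)"
proof -
  have "(\<Sum>k. glue (A k)) = (\<Sum>i<n. \<Sum>k. emeasure M (h i ` (A k \<inter> cell i)))"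
    unfolding glue_def by (rule suminf_sum) simp
  also have "\<dots> = (\<Sum>i<n. emeasure M (h i ` ((\<Union>k. A k) \<inter> cell i)))"
  proof (rule sum.cong[OF refl])
    fix i
    have sub: "A k \<inter> cell i \<subseteq> Q i" for k using cell_sub by blast
    have "disjoint_family (\<lambda>k. h i ` (A k \<inter> cell i))"
      unfolding disjoint_family_on_def
    proof (intro ballI impI)
      fix k l :: nat assume "k \<noteq> l"
      then have "A k \<inter> A l = {}" using dis by (simp add: disjoint_family_on_def)
      then have "(A k \<inter> cell i) \<inter> (A l \<inter> cell i) = {}" by blast
      then show "h i ` (A k \<inter> cell i) \<inter> h i ` (A l \<inter> cell i) = {}"
        using inj_on_image_Int[OF isometric_on_inj[OF h(1)] sub sub, of k l] by simp
    qed
    moreover have "range (\<lambda>k. h i ` (A k \<inter> cell i)) \<subseteq> sets M"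
      using A cell_sets sub by (auto intro!: chart_image_sets)
    ultimately have "(\<Sum>k. emeasure M (h i ` (A k \<inter> cell i))) = emeasure M (\<Union>k. h i ` (A k \<inter> cell i))"
      by (intro suminf_emeasure)
    moreover have "(\<Union>k. h i ` (A k \<inter> cell i)) = h i ` ((\<Union>k. A k) \<inter> cell i)" by blast
    ultimately show "(\<Sum>k. emeasure M (h i ` (A k \<inter> cell i))) = emeasure M (h i ` ((\<Union>k. A k) \<inter> cell i))"
      by simp
  qed
  finally show ?thesis by (simp add: glue_def)
qed

lemma sets_glued: "sets glued = sets borel"
  using sets.sigma_sets_eq[of "borel :: 'a measure"] by (simp add: glued_def)

lemma space_glued: "space glued = UNIV"
  using sets_eq_imp_space_eq[OF sets_glued] by simp

lemma emeasure_glued: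
  assumes "X \<in> sets borel"
  shows "emeasure glued X = glue X"
  unfolding glued_def
proof (rule emeasure_measure_of_sigma[OF _ _ _ assms])
  show "sigma_algebra UNIV (sets (borel :: 'a measure))"
    using sets.sigma_algebra_axioms[of "borel :: 'a measure"] by simp
  show "positive (sets borel) glue" by (simp add: positive_def glue_def)
  show "countably_additive (sets borel) glue"
    unfolding countably_additive_def using glue_countably_additive by simp
qed

lemma borel_isometric_copy_eq:
  assumes B: "compact B" "B \<subseteq> ball y0 s" and g: "isometric_on B g" "g ` B \<subseteq> ball y0 s"
    and X: "X \<in> sets borel" "X \<subseteq> B"
  shows "emeasure M (g ` X) = emeasure M X"
proof (rule isometric_image_measure_eqI[OF sets_M _ B(1) g(1) _ X])
  show "emeasure M UNIV \<noteq> \<infinity>" by (simp add: emeasure_finite)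
  fix X assume "compact X" and X: "X \<subseteq> B"
  then show "emeasure M (g ` X) = emeasure M X"
    using B g by (intro compact_isometric_copy_eq isometric_on_subset[OF g(1) X]) auto
qed

text \<open>The two charts differ by an isometry between compact subsets of the homogeneous ball.\<close>

lemma change_of_chart:
  assumes C: "compact C" "C \<subseteq> Q i" and f: "isometric_on C f" "f ` C \<subseteq> Q j"
    and X: "X \<in> sets borel" "X \<subseteq> C"
  shows "emeasure M (h j ` f ` X) = emeasure M (h i ` X)"
proof -
  have hC: "isometric_on C (h i)" by (rule isometric_on_subset[OF h(1) C(2)])
  let ?v = "inv_into C (h i)"
  have v: "?v (h i x) = x" if "x \<in> C" for x using isometric_on_inj[OF hC] that by (rule inv_into_f_f)
  have vC: "?v ` h i ` Y = Y" if "Y \<subseteq> C" for Y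
  proof -
    have "?v ` h i ` Y = (\<lambda>x. x) ` Y" unfolding image_image by (rule image_cong[OF refl]) (use v that in blast)
    then show ?thesis by simp
  qed
  let ?g = "\<lambda>z. h j (f (?v z))"
  have gim: "?g ` h i ` Y = h j ` f ` Y" if "Y \<subseteq> C" for Y
  proof -
    have "?g ` h i ` Y = h j ` f ` ?v ` h i ` Y" by (simp add: image_image)
    then show ?thesis by (simp add: vC[OF that])
  qed
  have iso1: "isometric_on (h i ` C) (\<lambda>z. f (?v z))"
    by (rule isometric_on_comp[OF isometric_on_inv[OF hC]]) (simp add: vC f(1))
  have "(\<lambda>z. f (?v z)) ` h i ` C = f ` C"
    using vC[OF order_refl] by (metis image_image)
  then have iso: "isometric_on (h i ` C) ?g"
    using isometric_on_comp[OF iso1, of "h j"] isometric_on_subset[OF h(1) f(2)] by simp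
  have "emeasure M (?g ` h i ` X) = emeasure M (h i ` X)"
  proof (rule borel_isometric_copy_eq[OF _ _ iso])
    show "compact (h i ` C)" by (rule compact_isometric_image[OF hC C(1)])
    show "h i ` C \<subseteq> ball y0 s" using h(2) C(2) by blast
    have "h j ` f ` C \<subseteq> ball y0 s" using h(2) f(2) by blast
    then show "?g ` h i ` C \<subseteq> ball y0 s" unfolding gim[OF order_refl] .
    show "h i ` X \<in> sets borel" by (rule isometric_image_borel[OF C(1) hC X])
    show "h i ` X \<subseteq> h i ` C" by (rule image_mono[OF X(2)])
  qed
  then show ?thesis by (simp only: gim[OF X(2)])
qed

text \<open>\<open>change_of_chart\<close> for the identity on the overlap of two chart domains
  shows that the part of \<open>X\<close> in each cell may be measured through chart
  \<open>j\<close> instead. The pieces then add up by injectivity of \<open>h j\<close>.\<close>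

lemma glued_eq_chart:
  assumes X: "X \<in> sets borel" "X \<subseteq> Q j"
  shows "emeasure glued X = emeasure M (h j ` X)"
proof -
  have XP: "X \<inter> cell i \<in> sets borel" "X \<inter> cell i \<subseteq> Q j" for i
    by (rule sets.Int[OF X(1) cell_sets]) (use X(2) in blast)
  have eq: "emeasure M (h i ` (X \<inter> cell i)) = emeasure M (h j ` (X \<inter> cell i))" for i
  proof -
    have "isometric_on (Q i \<inter> Q j) (\<lambda>x. x)" by (simp add: isometric_on_def)
    moreover have "X \<inter> cell i \<subseteq> Q i \<inter> Q j" using X(2) cell_sub[of i] by blast
    moreover have "(\<lambda>x. x) ` (Q i \<inter> Q j) \<subseteq> Q j" by simp
    ultimately have "emeasure M (h j ` (\<lambda>x. x) ` (X \<inter> cell i)) = emeasure M (h i ` (X \<inter> cell i))"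
      by (intro change_of_chart[OF compact_Int[OF Q Q] Int_lower1 _ _ XP(1)])
    then show ?thesis by simp
  qed
  have dis: "disjoint_family_on (\<lambda>i. h j ` (X \<inter> cell i)) {..<n}"
    unfolding disjoint_family_on_def
  proof (intro ballI impI)
    fix k l assume "k \<noteq> (l::nat)"
    then have "cell k \<inter> cell l = {}" using cell_disjoint by (simp add: disjoint_family_on_def)
    then have "(X \<inter> cell k) \<inter> (X \<inter> cell l) = {}" by blast
    then show "h j ` (X \<inter> cell k) \<inter> h j ` (X \<inter> cell l) = {}"
      using inj_on_image_Int[OF isometric_on_inj[OF h(1)] XP(2) XP(2), of k l] by simp
  qed
  have "emeasure glued X = (\<Sum>i<n. emeasure M (h j ` (X \<inter> cell i)))"
    by (simp add: emeasure_glued[OF X(1)] glue_def eq)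
  also have "\<dots> = emeasure M (\<Union>i<n. h j ` (X \<inter> cell i))"
    using dis XP by (intro sum_emeasure) (auto intro!: chart_image_sets)
  also have "(\<Union>i<n. h j ` (X \<inter> cell i)) = h j ` (X \<inter> (\<Union>i<n. cell i))" by blast
  also have "\<dots> = h j ` X" by (simp add: cell_cover)
  finally show ?thesis .
qed

section \<open>Non-triviality and invariance of the glued measure\<close>

lemma glued_finite: "emeasure glued UNIV \<noteq> \<infinity>"
  by (simp add: emeasure_glued glue_def emeasure_finite)

text \<open>On the compact ball \<open>B\<close> the charts are isometries between compact subsets
  of the homogeneous ball, so the glued measure and \<open>M\<close> agree on the pieces of
  \<open>B\<close>; and \<open>M\<close> gives positive mass to balls around
  \<open>y0\<close>.\<close>

lemma glued_pos: "emeasure glued UNIV \<noteq> 0"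
proof
  assume 0: "emeasure glued UNIV = 0"
  define B where "B = cball y0 (s/2)"
  have B: "compact B" "B \<subseteq> ball y0 s" 
    using K compact_Int_closed[of UNIV B] s by (auto simp: B_def)
  have "emeasure M (B \<inter> Q i) = 0" for i
  proof -
    have BQ: "compact (B \<inter> Q i)" by (rule compact_Int[OF B(1) Q])
    have "emeasure M (h i ` (B \<inter> Q i)) = emeasure M (B \<inter> Q i)"
      using BQ B(2) h(2)[of i] isometric_on_subset[OF h(1)[of i], of "B \<inter> Q i"]
      by (intro compact_isometric_copy_eq) auto
    moreover have "emeasure glued (B \<inter> Q i) = emeasure M (h i ` (B \<inter> Q i))"
      by (intro glued_eq_chart borel_closed compact_imp_closed BQ Int_lower2)
    moreover have "emeasure glued (B \<inter> Q i) \<le> emeasure glued UNIV"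
      by (rule emeasure_mono) (simp_all add: sets_glued)
    ultimately show ?thesis using 0 by simp
  qed
  moreover have "emeasure M (\<Union>i<n. B \<inter> Q i) \<le> (\<Sum>i<n. emeasure M (B \<inter> Q i))"
    using Q_sets borel_closed[OF compact_imp_closed[OF B(1)]]
    by (intro emeasure_subadditive_finite) (auto simp: sets_M)
  moreover have "(\<Union>i<n. B \<inter> Q i) = B" using Q_cover by blast
  ultimately have "emeasure M B = 0" by simp
  moreover have "emeasure M (ball y0 (s/2)) \<le> emeasure M B"
    using borel_closed[OF compact_imp_closed[OF B(1)]]
    by (intro emeasure_mono) (auto simp: B_def sets_M)
  ultimately show False using ball_y0_pos[of "s/2"] s by simp
qed

text \<open>The set is cut according to the cell into which its image falls; on each piece, source
  and target are seen through one chart each.\<close>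

lemma glued_compact_one_chart:
  assumes C: "compact C" "C \<subseteq> Q i" and f: "isometric_on C f"
  shows "emeasure glued (f ` C) = emeasure glued C"
proof -
  obtain f' where f': "f' \<in> borel_measurable borel" "\<And>x. x \<in> C \<Longrightarrow> f' x = f x"
  proof (rule that[of "\<lambda>x. if x \<in> C then f x else undefined"])
    show "(\<lambda>x. if x \<in> C then f x else undefined) \<in> borel_measurable borel"
      using isometric_on_continuous[OF f] borel_closed[OF compact_imp_closed[OF C(1)]]
      by (intro borel_measurable_continuous_on_if) auto
  qed simp
  define R where "R j = C \<inter> f' -` cell j" for j
  show ?thesis
  proof (rule isometric_image_measure_eq_partition[OF sets_glued C(1) f, where R = R and n = n])
    show "R j \<in> sets borel" for j
      using measurable_sets[OF f'(1) cell_sets] borel_closed[OF compact_imp_closed[OF C(1)]]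
      by (simp add: R_def sets.Int)
    then have R: "R j \<in> sets borel" for j .
    show "disjoint_family_on R {..<n}"
      using cell_disjoint unfolding disjoint_family_on_def R_def by blast
    show "(\<Union>j<n. R j) = C" using cell_cover unfolding R_def by blast
    fix j
    \<comment> \<open>The pieces \<open>R j\<close> are only known to be Borel, so the compact set
      required by \<open>change_of_chart\<close> is built from the whole chart domain
      \<open>Q j\<close>.\<close>
    define D where "D = C \<inter> f -` Q j"
    have D: "compact D"
    proof -
      have "closed D" unfolding D_def
        by (rule continuous_closed_preimage[OF isometric_on_continuous[OF f]])
          (intro compact_imp_closed C(1) Q)+
      then have "compact (C \<inter> D)" by (rule compact_Int_closed[OF C(1)])
      moreover have "C \<inter> D = D" by (auto simp: D_def)
      ultimately show ?thesis by simp
    qed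
    have D_sub: "D \<subseteq> C" "f ` D \<subseteq> Q j" by (auto simp: D_def)
    have fD: "isometric_on D f" by (rule isometric_on_subset[OF f D_sub(1)])
    have RD: "R j \<subseteq> D" using f'(2) cell_sub[of j] by (auto simp: R_def D_def)
    have "emeasure glued (f ` R j) = emeasure M (h j ` f ` R j)"
      using D_sub RD by (intro glued_eq_chart isometric_image_borel[OF D fD R RD]) blast
    also have "\<dots> = emeasure M (h i ` R j)"
      using D_sub C(2) by (intro change_of_chart[OF D _ fD _ R RD]) blast+
    also have "\<dots> = emeasure glued (R j)"
      using C(2) by (intro glued_eq_chart[symmetric] R) (auto simp: R_def)
    finally show "emeasure glued (f ` R j) = emeasure glued (R j)" .
  qed
qed

text \<open>Now the source is cut along the cells as well. The pieces are Borel, so equality is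
  passed from compact subsets of \<open>C \<inter> Q i\<close> to Borel subsets.\<close>

lemma glued_compact:
  assumes C: "compact C" and f: "isometric_on C f"
  shows "emeasure glued (f ` C) = emeasure glued C"
proof (rule isometric_image_measure_eq_partition[OF sets_glued C f, where R = "\<lambda>i. C \<inter> cell i" and n = n])
  have C_sets: "C \<in> sets borel" by (intro borel_closed compact_imp_closed C)
  show R: "C \<inter> cell i \<in> sets borel" for i using C_sets cell_sets by simp
  show "disjoint_family_on (\<lambda>i. C \<inter> cell i) {..<n}"
    using cell_disjoint unfolding disjoint_family_on_def by blast
  show "(\<Union>i<n. C \<inter> cell i) = C" using cell_cover by blast
  show "emeasure glued (f ` (C \<inter> cell i)) = emeasure glued (C \<inter> cell i)" for i
  proof (rule isometric_image_measure_eqI[OF sets_glued glued_finite, where C = "C \<inter> Q i"])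
    show "compact (C \<inter> Q i)" by (rule compact_Int[OF C Q])
    show "isometric_on (C \<inter> Q i) f" by (rule isometric_on_subset[OF f Int_lower1])
    show "emeasure glued (f ` X) = emeasure glued X" if X: "compact X" "X \<subseteq> C \<inter> Q i" for X
      using X(2) by (intro glued_compact_one_chart[OF X(1), of i] isometric_on_subset[OF f]) auto
    show "C \<inter> cell i \<subseteq> C \<inter> Q i" using cell_sub by blast
  qed (rule R)
qed

text \<open>Both \<open>U\<close> and its image are increasing unions of compact sets, hence Borel,
  and the equality passes to the limit. The image is not assumed open.\<close>

lemma glued_open:
  assumes U: "open U" and f: "isometric_on U f"
  shows "emeasure glued (f ` U) = emeasure glued U"
proof -
  define W where "W k = {x. ball x (1 / real (Suc k)) \<subseteq> U}" for k
  have W: "closed (W k)" "incseq W" "(\<Union>k. W k) = U" for k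
    using compact_exhaustion_of_open[OF U] unfolding W_def by blast+
  have Wc: "compact (W k)" for k using compact_Int_closed[OF K W(1)[of k]] by simp
  have WU: "W k \<subseteq> U" for k using W(3) by blast
  have fW: "isometric_on (W k) f" for k by (rule isometric_on_subset[OF f WU])
  have "(\<lambda>k. emeasure glued (f ` W k)) \<longlonglongrightarrow> emeasure glued (\<Union>k. f ` W k)"
  proof (rule Lim_emeasure_incseq)
    show "range (\<lambda>k. f ` W k) \<subseteq> sets glued"
      using Wc fW unfolding sets_glued by (auto intro!: borel_closed compact_imp_closed compact_isometric_image)
    show "incseq (\<lambda>k. f ` W k)" using W(2) by (auto simp: incseq_def intro!: image_mono)
  qed
  moreover have "(\<Union>k. f ` W k) = f ` U" unfolding W(3)[symmetric] by blast
  moreover have "emeasure glued (f ` W k) = emeasure glued (W k)" for k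
    by (rule glued_compact[OF Wc fW])
  ultimately have "(\<lambda>k. emeasure glued (W k)) \<longlonglongrightarrow> emeasure glued (f ` U)" by simp
  moreover have "(\<lambda>k. emeasure glued (W k)) \<longlonglongrightarrow> emeasure glued (\<Union>k. W k)"
    using W(1,2) by (intro Lim_emeasure_incseq) (auto simp: sets_glued intro: borel_closed)
  ultimately show ?thesis unfolding W(3) by (rule LIMSEQ_unique)
qed

end

lemma isometric_on_of_map: "isometric_map U V f \<Longrightarrow> isometric_on U f"
  by (simp add: isometric_map_def isometric_on_def)

section \<open>Existence of a compatible probability\<close>

theorem (in homogeneous_ball) strongly_isometrically_compatible_exists:
  "\<exists>m :: 'a measure. prob_space m \<and> strongly_isometrically_compatible m"
proof -
  obtain M :: "'a measure" where M: "sets M = sets borel" "prob_space M"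
    "\<And>U V f. open U \<Longrightarrow> open V \<Longrightarrow> isometric_on U f \<Longrightarrow> f ` U \<subseteq> V \<Longrightarrow> emeasure M U \<le> emeasure M V"
    using isometric_embedding_monotone_measure_exists[OF K] by blast
  interpret M: prob_space M by fact
  interpret homogeneous_ball_measure y0 s M by standard (rule M(1), rule M(3))
  define R where "R x e g \<longleftrightarrow> 0 < e \<and> isometric_on (ball x e) g \<and> g ` ball x e \<subseteq> ball y0 s"
    for x :: 'a and e and g :: "'a \<Rightarrow> 'a"
  have "\<exists>e g. R x e g" for x
  proof -
    obtain e g where e: "0 < e" "e \<le> s" "isometric_on (ball x e) g" "g ` ball x e \<subseteq> ball y0 e" "g x = y0"
      by (rule chart[OF s, where x = x])
    have "R x e g" unfolding R_def using e(1,3) order_trans[OF e(4) subset_ball[OF e(2)]] by simp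
    then show ?thesis by (intro exI)
  qed
  then obtain e g where "\<And>x. R x (e x) (g x)" by metis
  then have e: "0 < e x" and g: "isometric_on (ball x (e x)) (g x)"
    "g x ` ball x (e x) \<subseteq> ball y0 s" for x by (simp_all add: R_def)
  \<comment> \<open>Half the radius keeps the closed balls inside the chart domains.\<close>
  have "(UNIV :: 'a set) \<subseteq> (\<Union>x\<in>UNIV. ball x (e x / 2))" using e by auto
  then obtain F where F: "finite F" "(UNIV :: 'a set) \<subseteq> (\<Union>x\<in>F. ball x (e x / 2))"
    using compactE_image[OF K, of UNIV "\<lambda>x. ball x (e x / 2)"] by auto
  obtain p and n :: nat where p: "F = p ` {i. i < n}"
    using finite_imp_nat_seg_image_inj_on[OF F(1)] by blast
  define Q where "Q i = (if i < n then cball (p i) (e (p i) / 2) else {})" for i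
  have Q_sub: "Q i \<subseteq> ball (p i) (e (p i))" for i
  proof -
    have "e (p i) / 2 < e (p i)" using e by simp
    then show ?thesis by (auto simp: Q_def)
  qed
  interpret glued_charts y0 s M n Q "\<lambda>i. g (p i)"
  proof
    show "compact (Q i)" for i using compact_Int_closed[OF K, of "Q i"] by (simp add: Q_def)
    show "isometric_on (Q i) (g (p i))" for i by (rule isometric_on_subset[OF g(1) Q_sub])
    show "g (p i) ` Q i \<subseteq> ball y0 s" for i using g(2) Q_sub by blast
    show "n \<le> i \<Longrightarrow> Q i = {}" for i by (simp add: Q_def)
    have "z \<in> (\<Union>i<n. Q i)" for z
    proof -
      obtain x where "x \<in> F" "z \<in> ball x (e x / 2)" using F(2) by blast
      then obtain i where "i < n" "z \<in> ball (p i) (e (p i) / 2)" using p by blast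
      then have "z \<in> Q i" using ball_subset_cball by (auto simp: Q_def)
      then show ?thesis using \<open>i < n\<close> by blast
    qed
    then show "(\<Union>i<n. Q i) = UNIV" by blast
  qed
  define c where "c = emeasure glued UNIV"
  have c: "c \<noteq> 0" "c \<noteq> \<infinity>" using glued_pos glued_finite by (simp_all add: c_def)
  define m where "m = scale_measure (1 / c) glued"
  have m: "sets m = sets borel" by (simp add: m_def sets_glued)
  have "emeasure m (space m) = 1"
    using c by (simp add: m_def space_glued ennreal_divide_times c_def[symmetric] ennreal_divide_self less_top space_scale_measure)
  then have "prob_space m" by (rule prob_spaceI)
  moreover have "strongly_isometrically_compatible m"
    unfolding strongly_isometrically_compatible_def
  proof (intro conjI allI impI m)
    fix U V :: "'a set" and f :: "'a \<Rightarrow> 'a"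
    assume "open U" "isometric_map U V f"
    from glued_open[OF this(1) isometric_on_of_map[OF this(2)]]
    show "emeasure m (f ` U) = emeasure m U" by (simp add: m_def)
  qed
  ultimately show ?thesis by blast
qed

section \<open>Uniqueness\<close>

lemma ball_inner_set_borel: "{x. ball x r \<subseteq> U} \<in> sets borel" for U :: "'a::metric_space set"
proof -
  have "- {x. ball x r \<subseteq> U} = (\<Union>y\<in>-U. ball y r)" by (auto simp: subset_iff dist_commute)
  then have "open (- {x. ball x r \<subseteq> U})" by (simp add: open_UN)
  then show ?thesis by (intro borel_closed) (simp add: closed_def)
qed

text \<open>Fubini for the pairs at distance below \<open>r\<close> with first point in the inner
  set \<open>W\<close> and second point in \<open>U\<close>. A slice over a point of
  \<open>W\<close> is a full ball, of the same \<open>N\<close>-measure as the one around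
  \<open>y0\<close>; a slice over a point of \<open>U\<close> is contained in a ball, of the same
  \<open>M\<close>-measure as the one around \<open>y0\<close>.\<close>

lemma ball_measure_comparison:
  fixes y0 :: "'a::metric_space"
  assumes "homogeneous_ball_measure y0 s M" and "homogeneous_ball_measure y0 s N"
    and U: "open U" "U \<subseteq> ball y0 s" and r: "0 < r" "r \<le> s"
  shows "emeasure N (ball y0 r) * emeasure M {x. ball x r \<subseteq> U} \<le> emeasure M (ball y0 r) * emeasure N U"
proof -
  interpret M: homogeneous_ball_measure y0 s M by fact
  interpret N: homogeneous_ball_measure y0 s N by fact
  interpret MN: pair_sigma_finite M N
    by (rule pair_sigma_finite.intro[OF M.sigma_finite_measure_axioms N.sigma_finite_measure_axioms])
  define W where "W = {x. ball x r \<subseteq> U}"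
  have W: "W \<in> sets M" unfolding W_def M.sets_M by (rule ball_inner_set_borel)
  have U_sets: "U \<in> sets N" using U(1) by (simp add: N.sets_M borel_open)
  have WU: "W \<subseteq> U"
  proof
    fix x assume "x \<in> W"
    moreover have "x \<in> ball x r" using r(1) by simp
    ultimately show "x \<in> U" unfolding W_def by blast
  qed
  define Q where "Q = {w \<in> space (M \<Otimes>\<^sub>M N). fst w \<in> W \<and> snd w \<in> U \<and> dist (fst w) (snd w) < r}"
  have sp: "space (M \<Otimes>\<^sub>M N) = UNIV" by (simp add: space_pair_measure M.space_M N.space_M)
  have Q: "Q \<in> sets (M \<Otimes>\<^sub>M N)"
  proof -
    have "fst \<in> borel_measurable (M \<Otimes>\<^sub>M N)" "snd \<in> borel_measurable (M \<Otimes>\<^sub>M N)"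
      using measurable_fst[of M N] measurable_snd[of M N]
        measurable_cong_sets[OF refl M.sets_M] measurable_cong_sets[OF refl N.sets_M] by blast+
    from dist_less_sets[OF M.K this]
    have "{w \<in> space (M \<Otimes>\<^sub>M N). dist (fst w) (snd w) < r} \<in> sets (M \<Otimes>\<^sub>M N)" .
    moreover have "Q = (W \<times> U) \<inter> {w \<in> space (M \<Otimes>\<^sub>M N). dist (fst w) (snd w) < r}"
      unfolding Q_def sp by auto
    ultimately show ?thesis using W U_sets by (simp add: sets.Int pair_measureI)
  qed
  have sec1: "Pair x -` Q = (if x \<in> W then ball x r else {})" for x
    unfolding Q_def sp by (auto simp: W_def)
  have sec2: "(\<lambda>x. (x, y)) -` Q \<subseteq> (if y \<in> U then ball y r else {})" for y
    unfolding Q_def sp by (auto simp: dist_commute)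
  have "emeasure N (ball y0 r) * emeasure M W = (\<integral>\<^sup>+x. emeasure N (ball y0 r) * indicator W x \<partial>M)"
    by (rule nn_integral_cmult_indicator[symmetric, OF W])
  also have "\<dots> = (\<integral>\<^sup>+x. emeasure N (Pair x -` Q) \<partial>M)"
  proof (rule nn_integral_cong)
    fix x
    show "emeasure N (ball y0 r) * indicator W x = emeasure N (Pair x -` Q)"
    proof (cases "x \<in> W")
      case True
      then have "x \<in> ball y0 s" using WU U(2) by blast
      from N.ball_measure_eq[OF this r(2)] show ?thesis using True by (simp add: sec1)
    qed (simp add: sec1)
  qed
  also have "\<dots> = emeasure (M \<Otimes>\<^sub>M N) Q" by (rule N.emeasure_pair_measure_alt[OF Q, symmetric])
  also have "\<dots> = (\<integral>\<^sup>+y. emeasure M ((\<lambda>x. (x, y)) -` Q) \<partial>N)" by (rule MN.emeasure_pair_measure_alt2[OF Q])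
  also have "\<dots> \<le> (\<integral>\<^sup>+y. emeasure M (ball y0 r) * indicator U y \<partial>N)"
  proof (rule nn_integral_mono)
    fix y
    have "emeasure M ((\<lambda>x. (x, y)) -` Q) \<le> emeasure M (if y \<in> U then ball y r else {})"
      by (rule emeasure_mono[OF sec2]) (simp add: M.sets_M)
    also have "\<dots> = emeasure M (ball y0 r) * indicator U y"
      using M.ball_measure_eq[OF subsetD[OF U(2)] r(2)] by simp
    finally show "emeasure M ((\<lambda>x. (x, y)) -` Q) \<le> emeasure M (ball y0 r) * indicator U y" .
  qed
  also have "\<dots> = emeasure M (ball y0 r) * emeasure N U" by (rule nn_integral_cmult_indicator[OF U_sets])
  finally show ?thesis by (simp only: W_def)
qed

text \<open>The comparison for \<open>U\<close> is multiplied by the one for \<open>V\<close> with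
  the measures exchanged, and the ball measures cancel. As the radius tends to 0 the inner sets
  exhaust \<open>U\<close> and \<open>V\<close>.\<close>

lemma homogeneous_measures_cross_le:
  fixes y0 :: "'a::metric_space"
  assumes M: "homogeneous_ball_measure y0 s M" and N: "homogeneous_ball_measure y0 s N"
    and U: "open U" "U \<subseteq> ball y0 s" and V: "open V" "V \<subseteq> ball y0 s"
  shows "emeasure M U * emeasure N V \<le> emeasure N U * emeasure M V"
proof -
  interpret M: homogeneous_ball_measure y0 s M by fact
  interpret N: homogeneous_ball_measure y0 s N by fact
  define r where "r n = 1 / real (Suc n)" for n
  have lim: "(\<lambda>n. emeasure m {x. ball x (r n) \<subseteq> W}) \<longlonglongrightarrow> emeasure m W"
    if m: "sets m = sets borel" and W: "open W" for m :: "'a measure" and W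
  proof -
    have "(\<lambda>n. emeasure m {x. ball x (r n) \<subseteq> W}) \<longlonglongrightarrow> emeasure m (\<Union>n. {x. ball x (r n) \<subseteq> W})"
      using compact_exhaustion_of_open(2)[OF W] unfolding r_def
      by (intro Lim_emeasure_incseq) (auto simp: m ball_inner_set_borel)
    also have "(\<Union>n. {x. ball x (r n) \<subseteq> W}) = W"
      using compact_exhaustion_of_open(3)[OF W] unfolding r_def by simp
    finally show ?thesis .
  qed
  have "(\<lambda>n. emeasure M {x. ball x (r n) \<subseteq> U} * emeasure N {x. ball x (r n) \<subseteq> V})
      \<longlonglongrightarrow> emeasure M U * emeasure N V"
    by (rule tendsto_mult_ennreal[OF lim[OF M.sets_M U(1)] lim[OF N.sets_M V(1)]])
      (simp add: M.emeasure_finite N.emeasure_finite)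
  moreover obtain k where k: "r k < s" unfolding r_def by (rule nat_approx_posE[OF M.s])
  have "emeasure M {x. ball x (r n) \<subseteq> U} * emeasure N {x. ball x (r n) \<subseteq> V} \<le> emeasure N U * emeasure M V"
    if n: "k \<le> n" for n
  proof -
    have "r n \<le> r k" unfolding r_def using n by (intro divide_left_mono) auto
    then have r: "0 < r n" "r n \<le> s" using k by (auto simp: r_def)
    let ?a = "emeasure M (ball y0 (r n))" and ?b = "emeasure N (ball y0 (r n))"
    let ?u = "emeasure M {x. ball x (r n) \<subseteq> U}" and ?v = "emeasure N {x. ball x (r n) \<subseteq> V}"
    have "?b * ?u * (?a * ?v) \<le> ?a * emeasure N U * (?b * emeasure M V)"
      by (intro mult_mono ball_measure_comparison[OF M N U r] ball_measure_comparison[OF N M V r] zero_le)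
    then have "(?a * ?b) * (?u * ?v) \<le> (?a * ?b) * (emeasure N U * emeasure M V)"
      by (simp add: ac_simps)
    moreover have "?a * ?b \<noteq> 0" using M.ball_y0_pos[OF r(1)] N.ball_y0_pos[OF r(1)] by (simp add: zero_less_iff_neq_zero)
    moreover have "?a * ?b \<noteq> \<top>"
      using M.emeasure_finite N.emeasure_finite by (simp add: ennreal_mult_eq_top_iff)
    ultimately show ?thesis by (simp add: ennreal_mult_le_mult_iff)
  qed
  ultimately show ?thesis by (intro LIMSEQ_le_const2[of _ _ "emeasure N U * emeasure M V"]) auto
qed

section \<open>Proportionality on the ball and its transfer to the space\<close>

lemma (in homogeneous_ball) homogeneous_ball_measureI:
  assumes "prob_space m" "strongly_isometrically_compatible m"
  shows "homogeneous_ball_measure y0 s m"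
proof -
  interpret prob_space m by fact
  have sets: "sets m = sets borel"
    and inv: "\<And>U V f. open U \<Longrightarrow> open V \<Longrightarrow> isometric_map U V f \<Longrightarrow> emeasure m (f ` U) = emeasure m U"
    using assms(2) unfolding strongly_isometrically_compatible_def by blast+
  show ?thesis
  proof
    fix U V :: "'a set" and f :: "'a \<Rightarrow> 'a"
    assume U: "open U" and V: "open V" and f: "isometric_on U f" "f ` U \<subseteq> V"
    have "isometric_map U V f" using f by (simp add: isometric_map_def isometric_on_def)
    from inv[OF U V this] have "emeasure m U = emeasure m (f ` U)" by simp
    also have "\<dots> \<le> emeasure m V" using V by (intro emeasure_mono f) (simp add: sets borel_open)
    finally show "emeasure m U \<le> emeasure m V" .
  qed (rule sets)
qed

lemma (in homogeneous_ball) strongly_isometrically_compatible_unique: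
  fixes M N :: "'a measure"
  assumes M: "prob_space M" "strongly_isometrically_compatible M"
    and N: "prob_space N" "strongly_isometrically_compatible N"
  shows "M = N"
proof -
  note hM = homogeneous_ball_measureI[OF M] and hN = homogeneous_ball_measureI[OF N]
  interpret M: homogeneous_ball_measure y0 s M by fact
  interpret N: homogeneous_ball_measure y0 s N by fact
  let ?G = "ball y0 s"
  define a b where "a = emeasure M ?G" and "b = emeasure N ?G"
  have G: "?G \<in> sets M" "?G \<in> sets N" by (simp_all add: M.sets_M N.sets_M)
  have ab: "0 < a" "a \<noteq> \<infinity>" "0 < b" "b \<noteq> \<infinity>"
    using M.ball_y0_pos[OF s] N.ball_y0_pos[OF s] M.emeasure_finite N.emeasure_finite
    by (simp_all add: a_def b_def)
  \<comment> \<open>With the whole ball as second set, the two cross inequalities give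
    proportionality with factors \<open>a\<close> and \<open>b\<close>.\<close>
  have opens: "b * emeasure M U = a * emeasure N U" if U: "open U" "U \<subseteq> ?G" for U
    using homogeneous_measures_cross_le[OF hM hN U open_ball order_refl]
      homogeneous_measures_cross_le[OF hN hM U open_ball order_refl]
    by (intro antisym) (simp_all add: a_def b_def mult.commute)
  \<comment> \<open>No measurability is assumed, because images of open sets under charts will be
    inserted; on non-Borel sets both sides are 0.\<close>
  have borels: "b * emeasure M X = a * emeasure N X" if X: "X \<subseteq> ?G" for X
  proof (cases "X \<in> sets borel")
    case True
    let ?M = "scale_measure b (density M (indicator ?G))" and ?N = "scale_measure a (density N (indicator ?G))"
    have eM: "emeasure ?M Y = b * emeasure M (?G \<inter> Y)" and eN: "emeasure ?N Y = a * emeasure N (?G \<inter> Y)"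
      if "Y \<in> sets borel" for Y
      using that by (simp_all add: emeasure_restricted G M.sets_M N.sets_M)
    have "?M = ?N"
    proof (rule measure_eqI_generator_eq[where E = "Collect open" and \<Omega> = UNIV and A = "\<lambda>_. UNIV"])
      show "Int_stable (Collect open :: 'a set set)" by (auto simp: Int_stable_def)
      fix Y :: "'a set" assume "Y \<in> Collect open"
      then have Y: "open Y" by simp
      show "emeasure ?M Y = emeasure ?N Y"
        unfolding eM[OF borel_open[OF Y]] eN[OF borel_open[OF Y]]
        by (rule opens[OF open_Int[OF open_ball Y] Int_lower1])
    next
      show "emeasure ?M UNIV \<noteq> \<infinity>" for i :: nat
        unfolding eM[OF borel_open[OF open_UNIV]] using ab
        by (simp add: a_def[symmetric] ennreal_mult_eq_top_iff)
    next
      show "sets ?M = sigma_sets UNIV (Collect open)" "sets ?N = sigma_sets UNIV (Collect open)"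
        by (simp_all add: M.sets_M N.sets_M sets_borel_eq)
    qed simp_all
    moreover have "?G \<inter> X = X" using X by blast
    ultimately show ?thesis using eM[OF True] eN[OF True] by simp
  next
    case False
    then show ?thesis by (simp add: emeasure_notin_sets M.sets_M N.sets_M)
  qed
  \<comment> \<open>The open sets that embed into the ball form a generator of the Borel sets that
    is stable under intersection, and finitely many of them cover the space.\<close>
  define charted where "charted W \<longleftrightarrow> open W \<and> (\<exists>f. isometric_map W ?G f)" for W :: "'a set"
  have charted_subset: "charted W" if "charted W'" "open W" "W \<subseteq> W'" for W W'
  proof -
    obtain f where "isometric_map W' ?G f" using \<open>charted W'\<close> by (auto simp: charted_def)
    then have "isometric_map W ?G f" using that(3) by (auto simp: isometric_map_def)
    then show ?thesis using that(2) by (auto simp: charted_def)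
  qed
  have "\<exists>e>0. charted (ball x e)" for x
  proof -
    obtain e g where e: "0 < e" "e \<le> s" "isometric_on (ball x e) g" "g ` ball x e \<subseteq> ball y0 e" "g x = y0"
      by (rule chart[OF s, where x = x])
    have "isometric_map (ball x e) ?G g"
      using e(3) order_trans[OF e(4) subset_ball[OF e(2)]] by (simp add: isometric_map_def isometric_on_def)
    then have "charted (ball x e)" unfolding charted_def by (intro conjI open_ball exI)
    then show ?thesis using e(1) by blast
  qed
  then obtain e where e: "\<And>x. 0 < e x" "\<And>x. charted (ball x (e x))" by metis
  have "(UNIV :: 'a set) \<subseteq> (\<Union>x\<in>UNIV. ball x (e x))" using e(1) by auto
  then obtain F where F: "finite F" "(UNIV :: 'a set) \<subseteq> (\<Union>x\<in>F. ball x (e x))"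
    using compactE_image[OF K, of UNIV "\<lambda>x. ball x (e x)"] by auto
  have gen: "sets (borel :: 'a measure) = sigma_sets UNIV (Collect charted)"
    unfolding sets_borel_eq
  proof (rule sigma_sets_eqI)
    show "W \<in> sigma_sets UNIV (Collect open)" if "W \<in> Collect charted" for W
      using that by (intro sigma_sets.Basic) (simp add: charted_def)
    show "U \<in> sigma_sets UNIV (Collect charted)" if "U \<in> Collect open" for U :: "'a set"
    proof -
      have "U \<inter> ball x (e x) \<in> sigma_sets UNIV (Collect charted)" for x
        using that charted_subset[OF e(2)[of x], of "U \<inter> ball x (e x)"]
        by (intro sigma_sets.Basic) (simp add: open_Int)
      then have "(\<Union>x\<in>F. U \<inter> ball x (e x)) \<in> sigma_sets UNIV (Collect charted)"
        using sigma_algebra_sigma_sets[of "Collect charted" "UNIV :: 'a set"] F(1)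
        by (intro sets.finite_UN[of F _ "sigma UNIV (Collect charted)", simplified]) auto
      moreover have "(\<Union>x\<in>F. U \<inter> ball x (e x)) = U" using F(2) by blast
      ultimately show ?thesis by simp
    qed
  qed
  have eq: "scale_measure b M = scale_measure a N"
  proof (rule measure_eqI_generator_eq_countable[where E = "Collect charted" and \<Omega> = UNIV
        and A = "(\<lambda>x. ball x (e x)) ` F"])
    show "Int_stable (Collect charted)"
    proof (rule Int_stableI)
      fix W W' assume "W \<in> Collect charted" "W' \<in> Collect charted"
      then show "W \<inter> W' \<in> Collect charted"
        using charted_subset[of W "W \<inter> W'"] by (simp add: charted_def open_Int)
    qed
    fix W assume "W \<in> Collect charted"
    then obtain f where W: "open W" and f: "isometric_map W ?G f" unfolding charted_def by blast
    \<comment> \<open>Here compatibility is used for maps whose image need not be open; it moves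
      \<open>W\<close> into the ball, where the two measures are proportional.\<close>
    have "emeasure M (f ` W) = emeasure M W" "emeasure N (f ` W) = emeasure N W"
      using M(2) N(2) W f open_ball[of y0 s] unfolding strongly_isometrically_compatible_def by metis+
    moreover have "f ` W \<subseteq> ?G" using f by (simp add: isometric_map_def)
    ultimately show "emeasure (scale_measure b M) W = emeasure (scale_measure a N) W"
      using borels[of "f ` W"] by simp
  next
    fix A assume "A \<in> (\<lambda>x. ball x (e x)) ` F"
    show "emeasure (scale_measure b M) A \<noteq> \<infinity>"
      using ab M.emeasure_finite by (simp add: ennreal_mult_eq_top_iff)
  qed (use e(2) F in \<open>auto simp: M.sets_M N.sets_M gen[symmetric] countable_finite\<close>)
  \<comment> \<open>Both measures have total mass 1, so the factors coincide.\<close>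
  have "b = a"
    using arg_cong[OF eq, of "\<lambda>m. emeasure m UNIV"] M.emeasure_space_1 N.emeasure_space_1
    by (simp add: M.space_M N.space_M)
  show "M = N"
  proof (rule measure_eqI)
    show "sets M = sets N" by (simp add: M.sets_M N.sets_M)
    fix A
    have "b * emeasure M A = b * emeasure N A"
      using arg_cong[OF eq, of "\<lambda>m. emeasure m A"] \<open>b = a\<close> by simp
    moreover have "b \<noteq> \<top>" "b \<noteq> 0" using ab(3,4) by simp_all
    ultimately show "emeasure M A = emeasure N A" unfolding ennreal_mult_cancel_left by simp
  qed
qed

theorem theorem10:
  fixes Km :: "'a::metric_space set"
  assumes "compact (UNIV :: 'a set)"
    and "\<And>x y :: 'a. hom_maximal x \<Longrightarrow> hom_maximal y \<Longrightarrow> hom_equivalent x y"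
    and "greatest_hom_component Km"
    and "interior Km \<noteq> {}"
  shows "\<exists>!m :: 'a measure. prob_space m \<and> strongly_isometrically_compatible m"
proof -
  \<comment> \<open>The greatest component supplies the homogeneous ball on which both existence and
    uniqueness rest.\<close>
  obtain y0 :: 'a and s where "s > 0"
    "\<And>z. z \<in> ball y0 s \<Longrightarrow> \<exists>f. isometry_between (ball z s) (ball y0 s) f \<and> f z = y0"
    "\<And>x. hom_le x y0"
    by (rule greatest_hom_component_core[OF assms(1,3,4)]) (rule that)
  then interpret homogeneous_ball y0 s using assms(1) by unfold_locales
  show ?thesis
    using strongly_isometrically_compatible_exists strongly_isometrically_compatible_unique by (rule ex_ex1I) simp_all
qed

end
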